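(* (1) Let $K$ be a $2n\times 2n$ nonsingular alternate matrix over $\mathbb{F}_q$, let $Sp_{2n}(\mathbb{F}_q,K)$ be the symplectic group of degree $2n$ with respect to $K$ over $\mathbb{F}_q$, and let $W$ be the standard ($2n$-dimensional) representation of $Sp_{2n}(\mathbb{F}_q,K)$. Then, for any $m\geq 1$, $$\mathbb{F}_q(mW)^{Sp_{2n}(\mathbb{F}_q,K)}=\mathbb{F}_q\big(Q_{i1}^{(k)}\mid 1\leq i\leq m,\ 1\leq k\leq 2n\big),$$ where $Q_{ij}^{(k)}={}^{t}X_i\cdot K\cdot X_j^{q^k}$. (2) Suppose $\mathbb{F}_q$ has odd characteristic. Let $H$ be an $n\times n$ nonsingular Hermitian matrix over $\mathbb{F}_{q^2}$, let $U(\mathbb{F}_{q^2},H)$ be the unitary group of degree $n$ with respect to $H$ over $\mathbb{F}_{q^2}$, and let $W$ be the standard ($n$-dimensional) representation of $U(\mathbb{F}_{q^2},H)$ over $\mathbb{F}_{q^2}$. Then, for any $m\geq 1$, $$\mathbb{F}_{q^2}(mW)^{U(\mathbb{F}_{q^2},H)}=\mathbb{F}_{q^2}\big(H_{i1}^{(k)}\mid 1\leq i\leq m,\ 0\leq k\leq n-1\big),$$ where $H_{ij}^{(k)}={}^{t}X_i\cdot H\cdot X_j^{q^{2k+1}}$. (3) Suppose $\mathbb{F}_q$ has odd characteristic. Let $A$ be an $n\times n$ nonsingular symmetric matrix over $\mathbb{F}_q$, let $O_n(\mathbb{F}_q,A)$ be the orthogonal group of degree $n$ with respect to $A$ over $\mathbb{F}_q$,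 and let $W$ be the standard ($n$-dimensional) representation of $O_n(\mathbb{F}_q,A)$. Then, for any $m\geq 1$, $$\mathbb{F}_q(mW)^{O_n(\mathbb{F}_q,A)}=\mathbb{F}_q\big(P_{i1}^{(k)}\mid 1\leq i\leq m,\ 0\leq k\leq n-1\big),$$ where $P_{ij}^{(k)}={}^{t}X_i\cdot A\cdot X_j^{q^k}$.
   Context: ${}^{t}(\cdot)$ denotes transpose. Let $N=\dim W$ (so $N=2n$ in (1) and $N=n$ in (2), (3)), and let $F$ be the ground field ($F=\mathbb{F}_q$ in (1), (3); $F=\mathbb{F}_{q^2}$ in (2)). $mW$ is the direct sum of $m$ copies of $W$, with diagonal group action. Write $F(mW)=F(x_{ij}\mid 1\leq i\leq m,1\leq j\leq N)$ for the rational function field in $mN$ variables; $X_i={}^{t}(x_{i1},\dots,x_{iN})$ is the column vector of coordinates of the $i$-th copy, and $X_i^{q^k}={}^{t}(x_{i1}^{q^k},\dots,x_{iN}^{q^k})$. Groups: a matrix $K=(k_{ij})$ is alternate if $k_{ij}=-k_{ji}$ for $i\neq j$ and $k_{ii}=0$; $Sp_{2n}(\mathbb{F}_q,K)=\{T\in\mathrm{GL}_{2n}(\mathbb{F}_q)\mid TK\,{}^{t}T=K\}$. On $\mathbb{F}_{q^2}$ there is the involution $a\mapsto\overline{a}=a^q$, applied entrywise to matrices; $H$ is Hermitian if ${}^{t}\overline{H}=H$; $U(\mathbb{F}_{q^2},H)=\{T\in\mathrm{GL}_n(\mathbb{F}_{q^2})\mid TH\,{}^{t}\overline{T}=H\}$.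 $O_n(\mathbb{F}_q,A)=\{T\in\mathrm{GL}_n(\mathbb{F}_q)\mid TA\,{}^{t}T=A\}$. Action: an element $T$ of the group acts on $F(mW)$ by the $F$-algebra automorphism sending the row vector of variables ${}^{t}X_i$ to ${}^{t}X_i\cdot T$ for every $i$ (so that $Q_{ij}^{(k)}$, $H_{ij}^{(k)}$, $P_{ij}^{(k)}$ are invariant). A superscript group denotes the subfield of elements fixed by that group. *)

theory Defs
  imports
    "HOL-Analysis.Analysis"
    "HOL-Library.Poly_Mapping"
    "HOL-Computational_Algebra.Fraction_Field"
    "HOL-Algebra.Generated_Fields"
    "HOL-Algebra.Algebraic_Closure_Type"
begin

unbundle no Formal_Power_Series.fps_syntax

section \<open>The rational function field on several copies of a representation\<close>

datatype ('m, 'n) coord = Coord 'm 'n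

text \<open>
  The library shows that multivariate polynomials form an integral domain only for a linearly
  ordered type of variables. An arbitrary well-ordering of the variables is therefore fixed;
  nothing below depends on which one it is.
\<close>

definition coord_order :: "('m, 'n) coord rel" where
  "coord_order = (SOME r. well_order_on UNIV r)"

lemma coord_order: "linear_order_on UNIV (coord_order :: ('m, 'n) coord rel)"
proof -
  have "\<exists>r :: ('m, 'n) coord rel. well_order_on UNIV r"
    using well_ordering by metis
  then have "well_order_on UNIV (coord_order :: ('m, 'n) coord rel)"
    unfolding coord_order_def by (rule someI_ex)
  then show ?thesis
    by (simp add: well_order_on_def)
qed

instantiation coord :: (type, type) linorder
begin

definition "x \<le> y \<longleftrightarrow> (x, y) \<in> coord_order" for x y :: "('a, 'b) coord"

definition "x < y \<longleftrightarrow> x \<le> y \<and> \<not> y \<le> x" for x y :: "('a, 'b) coord"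

instance
proof
  note defs = linear_order_on_def partial_order_on_def preorder_on_def refl_on_def total_on_def
    trans_def antisym_def
  fix x y z :: "('a, 'b) coord"
  show "x < y \<longleftrightarrow> x \<le> y \<and> \<not> y \<le> x"
    by (rule less_coord_def)
  show "x \<le> x"
    using coord_order unfolding less_eq_coord_def defs by auto
  show "x \<le> z" if "x \<le> y" "y \<le> z"
    using coord_order that unfolding less_eq_coord_def defs by blast
  show "x = y" if "x \<le> y" "y \<le> x"
    using coord_order that unfolding less_eq_coord_def defs by blast
  show "x \<le> y \<or> y \<le> x"
    using coord_order unfolding less_eq_coord_def defs by (cases "x = y") auto
qed

end

text \<open>
  Polynomials and rational functions over \<^typ>\<open>'a\<close> in the coordinates of the \<^typ>\<open>'m\<close>-indexed
  direct sum of copies of an \<^typ>\<open>'n\<close>-dimensional space: \<open>Coord i j\<close> is the \<open>j\<close>-th coordinate on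
  the \<open>i\<close>-th copy.
\<close>

type_synonym ('a, 'm, 'n) mpol = "(('m, 'n) coord \<Rightarrow>\<^sub>0 nat) \<Rightarrow>\<^sub>0 'a"

type_synonym ('a, 'm, 'n) ratfun = "('a, 'm, 'n) mpol fract"

definition pconst :: "'a::field \<Rightarrow> ('a, 'm, 'n) mpol" where
  "pconst c = Poly_Mapping.single 0 c"

definition pvar :: "('m, 'n) coord \<Rightarrow> ('a::field, 'm, 'n) mpol" where
  "pvar v = Poly_Mapping.single (Poly_Mapping.single v 1) 1"

definition rconst :: "'a::field \<Rightarrow> ('a, 'm, 'n) ratfun" where
  "rconst c = Fract (pconst c) 1"

definition coord_vec :: "'m \<Rightarrow> ('a::field, 'm, 'n::finite) ratfun ^ 'n" where
  "coord_vec i = (\<chi> j. Fract (pvar (Coord i j)) 1)"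

definition psubst ::
    "(('m, 'n) coord \<Rightarrow> ('a, 'm, 'n) mpol) \<Rightarrow> ('a::field, 'm, 'n) mpol \<Rightarrow> ('a, 'm, 'n) mpol" where
  "psubst s p = (\<Sum>a\<in>Poly_Mapping.keys p. pconst (Poly_Mapping.lookup p a) *
      (\<Prod>v\<in>Poly_Mapping.keys a. s v ^ Poly_Mapping.lookup a v))"

fun lin_coord :: "'a::field ^ 'n ^ 'n \<Rightarrow> ('m, 'n::finite) coord \<Rightarrow> ('a, 'm, 'n) mpol" where
  "lin_coord T (Coord i j) = ((\<chi> l. pvar (Coord i l)) v* map_matrix pconst T) $ j"

text \<open>
  The action of an invertible matrix \<open>T\<close> by linear substitution in numerator and denominator; for
  such \<open>T\<close> the value does not depend on the fraction chosen, see \<open>act_Fract\<close> below.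
\<close>

definition act :: "'a::field ^ 'n ^ 'n \<Rightarrow> ('a, 'm, 'n::finite) ratfun \<Rightarrow> ('a, 'm, 'n) ratfun" where
  "act T f = (THE g. \<exists>a b. b \<noteq> 0 \<and> f = Fract a b \<and>
      g = Fract (psubst (lin_coord T) a) (psubst (lin_coord T) b))"

definition fixed_field :: "('a::field ^ 'n ^ 'n) set \<Rightarrow> ('a, 'm, 'n::finite) ratfun set" where
  "fixed_field G = {f. \<forall>T\<in>G. act T f = f}"

definition adjoin :: "('a::field, 'm, 'n) ratfun set \<Rightarrow> ('a, 'm, 'n) ratfun set" where
  "adjoin S = generate_field ring_of_type_algebra (range rconst \<union> S)"

text \<open>
  \<open>frob_form M i j e\<close> is the product of the row vector of the \<open>i\<close>-th copy, the matrix \<open>M\<close>, and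
  the column vector of \<open>e\<close>-th powers of the coordinates of the \<open>j\<close>-th copy.
\<close>

definition frob_form ::
    "'a::field ^ 'n ^ 'n \<Rightarrow> 'm \<Rightarrow> 'm \<Rightarrow> nat \<Rightarrow> ('a, 'm, 'n::finite) ratfun" where
  "frob_form M i j e =
      scalar_product (coord_vec i v* map_matrix rconst M) (\<chi> l. (coord_vec j $ l) ^ e)"


section \<open>The classical groups\<close>

definition alternate_matrix :: "'a::field ^ 'n ^ 'n \<Rightarrow> bool" where
  "alternate_matrix K \<longleftrightarrow> (\<forall>i j. i \<noteq> j \<longrightarrow> K $ i $ j = - (K $ j $ i)) \<and> (\<forall>i. K $ i $ i = 0)"

definition symmetric_matrix :: "'a ^ 'n ^ 'n \<Rightarrow> bool" where
  "symmetric_matrix A \<longleftrightarrow> transpose A = A"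

text \<open>The involution on a field with \<open>q\<^sup>2\<close> elements, applied entrywise.\<close>

definition conj_matrix :: "nat \<Rightarrow> 'a::field ^ 'n ^ 'n \<Rightarrow> 'a ^ 'n::finite ^ 'n" where
  "conj_matrix q M = map_matrix (\<lambda>a. a ^ q) M"

definition hermitian_matrix :: "nat \<Rightarrow> 'a::field ^ 'n ^ 'n::finite \<Rightarrow> bool" where
  "hermitian_matrix q H \<longleftrightarrow> transpose (conj_matrix q H) = H"

definition symplectic_group :: "'a::field ^ 'n ^ 'n \<Rightarrow> ('a ^ 'n ^ 'n::finite) set" where
  "symplectic_group K = {T. invertible T \<and> T ** K ** transpose T = K}"

definition unitary_group :: "nat \<Rightarrow> 'a::field ^ 'n ^ 'n \<Rightarrow> ('a ^ 'n ^ 'n::finite) set" where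
  "unitary_group q H = {T. invertible T \<and> T ** H ** transpose (conj_matrix q T) = H}"

definition orthogonal_group :: "'a::field ^ 'n ^ 'n \<Rightarrow> ('a ^ 'n ^ 'n::finite) set" where
  "orthogonal_group A = {T. invertible T \<and> T ** A ** transpose T = A}"


section \<open>The action is by field automorphisms over the ground field\<close>

lemma pconst_mult: "pconst (c * d) = pconst c * pconst d"
  by (simp add: pconst_def mult_single)

lemma pconst_sum: "pconst (sum f B) = (\<Sum>b\<in>B. pconst (f b))"
  by (induction B rule: infinite_finite_induct) (simp_all add: pconst_def single_add)

lemma psubst_superset:
  assumes "finite B" "Poly_Mapping.keys p \<subseteq> B"
  shows "psubst s p = (\<Sum>a\<in>B. pconst (Poly_Mapping.lookup p a) *
      (\<Prod>v\<in>Poly_Mapping.keys a. s v ^ Poly_Mapping.lookup a v))"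
  unfolding psubst_def
  by (rule sum.mono_neutral_left) (use assms in \<open>auto simp: pconst_def in_keys_iff\<close>)

lemma psubst_add: "psubst s (p + q) = psubst s p + psubst s q"
proof -
  let ?B = "Poly_Mapping.keys p \<union> Poly_Mapping.keys q"
  have "Poly_Mapping.keys (p + q) \<subseteq> ?B"
    by (rule Poly_Mapping.keys_add)
  then show ?thesis
    by (simp add: psubst_superset[of ?B] lookup_add pconst_def single_add algebra_simps
        sum.distrib)
qed

lemma psubst_0 [simp]: "psubst s 0 = 0"
  by (simp add: psubst_def)

lemma psubst_single: "psubst s (Poly_Mapping.single a c) =
    pconst c * (\<Prod>v\<in>Poly_Mapping.keys a. s v ^ Poly_Mapping.lookup a v)"
  by (simp add: psubst_superset[of "{a}"] pconst_def)

lemma psubst_pconst [simp]: "psubst s (pconst c) = pconst c"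
  by (subst (1) pconst_def) (simp add: psubst_single)

lemma psubst_1 [simp]: "psubst s 1 = 1"
  using psubst_pconst[of s 1] by (simp add: pconst_def)

lemma psubst_pvar [simp]: "psubst s (pvar v) = s v"
  unfolding pvar_def by (simp add: psubst_single pconst_def)

lemma mpol_induct [case_names single add]:
  fixes p :: "('a::field, 'm, 'n) mpol"
  assumes single: "\<And>a c. P (Poly_Mapping.single a c)" and add: "\<And>p q. P p \<Longrightarrow> P q \<Longrightarrow> P (p + q)"
  shows "P p"
proof (induction p rule: update_induct)
  case const
  show ?case
    using single[of 0 0] by simp
next
  case (update p a c)
  have "Poly_Mapping.update a c p = p + Poly_Mapping.single a c"
    using update.hyps
    by (intro poly_mapping_eqI) (auto simp: lookup_update lookup_add lookup_single in_keys_iff when_def)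
  then show ?case
    using add update.IH single by simp
qed

lemma prod_keys_add:
  fixes s :: "'v \<Rightarrow> 'r::comm_ring_1"
  shows "(\<Prod>v\<in>Poly_Mapping.keys (a + b). s v ^ Poly_Mapping.lookup (a + b) v) =
    (\<Prod>v\<in>Poly_Mapping.keys a. s v ^ Poly_Mapping.lookup a v) *
    (\<Prod>v\<in>Poly_Mapping.keys b. s v ^ Poly_Mapping.lookup b v)"
proof -
  let ?B = "Poly_Mapping.keys a \<union> Poly_Mapping.keys b"
  have *: "(\<Prod>v\<in>Poly_Mapping.keys d. s v ^ Poly_Mapping.lookup d v) =
      (\<Prod>v\<in>?B. s v ^ Poly_Mapping.lookup d v)" if "Poly_Mapping.keys d \<subseteq> ?B" for d
    by (rule prod.mono_neutral_left) (use that in \<open>auto simp: in_keys_iff\<close>)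
  show ?thesis
    unfolding *[OF Poly_Mapping.keys_add] *[OF Un_upper1] *[OF Un_upper2]
    by (simp add: lookup_add power_add prod.distrib)
qed

lemma psubst_mult: "psubst s (p * q) = psubst s p * psubst s q"
proof (induction p rule: mpol_induct)
  case (single a c)
  show ?case
  proof (induction q rule: mpol_induct)
    case (single b d)
    show ?case
      by (simp add: mult_single psubst_single prod_keys_add pconst_mult mult_ac)
  qed (simp add: psubst_add algebra_simps)
qed (simp add: psubst_add algebra_simps)

lemma psubst_sum: "psubst s (sum f B) = (\<Sum>b\<in>B. psubst s (f b))"
  by (induction B rule: infinite_finite_induct) (simp_all add: psubst_add)

lemma psubst_prod: "psubst s (prod f B) = (\<Prod>b\<in>B. psubst s (f b))"
  by (induction B rule: infinite_finite_induct) (simp_all add: psubst_mult)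

lemma psubst_power: "psubst s (p ^ e) = psubst s p ^ e"
  by (induction e) (simp_all add: psubst_mult)

lemma psubst_psubst: "psubst s (psubst t p) = psubst (\<lambda>v. psubst s (t v)) p"
  unfolding psubst_def[of t] psubst_def[of "\<lambda>v. psubst s (t v)"]
  by (simp add: psubst_sum psubst_mult psubst_prod psubst_power)

lemma prod_pvar: "(\<Prod>v\<in>Poly_Mapping.keys a. pvar v ^ Poly_Mapping.lookup a v) =
    (Poly_Mapping.single a 1 :: ('a::field, 'm, 'n) mpol)"
proof -
  have pow: "pvar v ^ e = (Poly_Mapping.single (Poly_Mapping.single v e) 1 :: ('a, 'm, 'n) mpol)"
    for v e
    by (induction e) (simp_all add: pvar_def mult_single single_add[symmetric])
  show ?thesis
  proof (induction a rule: update_induct)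
    case const
    show ?case by simp
  next
    case (update a v e)
    have upd: "Poly_Mapping.update v e a = a + Poly_Mapping.single v e"
      using update.hyps
      by (intro poly_mapping_eqI)
        (auto simp: lookup_update lookup_add lookup_single in_keys_iff when_def)
    show ?case
      unfolding upd prod_keys_add update.IH by (simp add: pow mult_single)
  qed
qed

lemma psubst_id: "psubst pvar p = p"
proof (induction p rule: mpol_induct)
  case (single a c)
  show ?case
    by (simp add: psubst_single prod_pvar pconst_def mult_single)
qed (simp add: psubst_add)

lemma psubst_lin_coord:
  fixes p :: "('a::field, 'm, 'n::finite) mpol"
  shows "psubst (lin_coord T) (psubst (lin_coord U) p) = psubst (lin_coord (T ** U)) p"
proof -
  have "psubst (lin_coord T) (lin_coord U v) = lin_coord (T ** U) v" for v :: "('m, 'n) coord"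
  proof (cases v)
    case (Coord i j)
    have "psubst (lin_coord T) (lin_coord U v) =
        (\<Sum>l\<in>UNIV. \<Sum>k\<in>UNIV. pvar (Coord i k) * pconst (T $ k $ l) * pconst (U $ l $ j))"
      by (simp add: Coord vector_matrix_mult_def psubst_sum psubst_mult sum_distrib_left
          sum_distrib_right mult_ac)
    also have "\<dots> =
        (\<Sum>k\<in>UNIV. \<Sum>l\<in>UNIV. pvar (Coord i k) * pconst (T $ k $ l) * pconst (U $ l $ j))"
      by (rule sum.swap)
    also have "\<dots> = lin_coord (T ** U) v"
      by (simp add: Coord vector_matrix_mult_def matrix_matrix_mult_def pconst_sum pconst_mult
          sum_distrib_left sum_distrib_right mult_ac)
    finally show ?thesis .
  qed
  then show ?thesis
    by (simp add: psubst_psubst)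
qed

lemma lin_coord_mat_1:
  "lin_coord (mat 1) = (pvar :: ('m, 'n::finite) coord \<Rightarrow> ('a::field, 'm, 'n) mpol)"
proof
  fix v :: "('m, 'n) coord"
  show "lin_coord (mat 1) v = (pvar v :: ('a, 'm, 'n) mpol)"
  proof (cases v)
    case (Coord i j)
    have "map_matrix pconst (mat 1 :: 'a ^ 'n ^ 'n) = (mat 1 :: ('a, 'm, 'n) mpol ^ 'n ^ 'n)"
      by (simp add: vec_eq_iff mat_def pconst_def)
    then show ?thesis
      by (simp add: Coord)
  qed
qed

lemma psubst_eq_0_iff:
  assumes "invertible T"
  shows "psubst (lin_coord T) p = 0 \<longleftrightarrow> p = 0"
proof
  obtain U where "U ** T = mat 1"
    using assms unfolding invertible_def by blast
  then have "psubst (lin_coord U) (psubst (lin_coord T) p) = p"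
    by (simp add: psubst_lin_coord lin_coord_mat_1 psubst_id)
  then show "p = 0" if "psubst (lin_coord T) p = 0"
    using that by simp
qed simp

lemma act_Fract:
  assumes T: "invertible T" and b: "b \<noteq> 0"
  shows "act T (Fract a b) = Fract (psubst (lin_coord T) a) (psubst (lin_coord T) b)"
  unfolding act_def
proof (rule the_equality)
  fix g
  assume "\<exists>a' b'. b' \<noteq> 0 \<and> Fract a b = Fract a' b' \<and>
      g = Fract (psubst (lin_coord T) a') (psubst (lin_coord T) b')"
  then obtain a' b' where *: "b' \<noteq> 0" "Fract a b = Fract a' b'"
      "g = Fract (psubst (lin_coord T) a') (psubst (lin_coord T) b')"
    by blast
  then have "a * b' = a' * b"
    using b by (simp add: eq_fract)
  then have "psubst (lin_coord T) a * psubst (lin_coord T) b' =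
      psubst (lin_coord T) a' * psubst (lin_coord T) b"
    by (metis psubst_mult)
  then show "g = Fract (psubst (lin_coord T) a) (psubst (lin_coord T) b)"
    using * b T by (simp add: eq_fract psubst_eq_0_iff)
qed (use b in blast)

lemma act_act:
  assumes "invertible T" "invertible U"
  shows "act T (act U f) = act (T ** U) f"
  by (cases f) (simp add: assms act_Fract invertible_mult psubst_eq_0_iff psubst_lin_coord)

lemma act_coord_vec:
  fixes T :: "'a::field ^ 'n ^ 'n::finite" and i :: 'm
  assumes "invertible T"
  shows "(\<chi> j. act T (coord_vec i $ j)) =
    (coord_vec i v* map_matrix rconst T :: ('a, 'm, 'n) ratfun ^ 'n)"
proof -
  have sum: "Fract (sum f B) 1 = (\<Sum>b\<in>B. Fract (f b) 1)" for f :: "'n \<Rightarrow> ('a, 'm, 'n) mpol" and B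
  proof (induction B rule: infinite_finite_induct)
    case (insert x F)
    have "Fract (p + q) 1 = Fract p 1 + Fract q 1" for p q :: "('a, 'm, 'n) mpol"
      by simp
    with insert show ?case
      by (simp only: sum.insert not_False_eq_True)
  qed (simp_all add: Zero_fract_def)
  show ?thesis
    using assms
    by (simp add: vec_eq_iff coord_vec_def act_Fract vector_matrix_mult_def rconst_def sum)
qed

theorem act_automorphism:
  fixes T :: "'a::field ^ 'n ^ 'n::finite" and f g :: "('a, 'm, 'n) ratfun"
  assumes "invertible T"
  shows "bij (act T :: ('a, 'm, 'n) ratfun \<Rightarrow> _)"
    and "act T (f + g) = act T f + act T g"
    and "act T (f * g) = act T f * act T g"
    and "act T (rconst c :: ('a, 'm, 'n) ratfun) = rconst c"
proof -
  obtain U where U: "U ** T = mat 1" "T ** U = mat 1"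
    using assms unfolding invertible_def by blast
  then have "invertible U"
    unfolding invertible_def by blast
  moreover have "act (mat 1) h = h" for h :: "('a, 'm, 'n) ratfun"
    by (cases h) (simp add: act_Fract invertible_def lin_coord_mat_1 psubst_id)
  ultimately show "bij (act T :: ('a, 'm, 'n) ratfun \<Rightarrow> _)"
    using assms U by (intro o_bij[of "act U"]) (auto simp: act_act fun_eq_iff)
  show "act T (f + g) = act T f + act T g"
    by (cases f, cases g) (simp add: assms act_Fract psubst_eq_0_iff psubst_add psubst_mult)
  show "act T (f * g) = act T f * act T g"
    by (cases f, cases g) (simp add: assms act_Fract psubst_mult)
  show "act T (rconst c :: ('a, 'm, 'n) ratfun) = rconst c"
    by (simp add: assms rconst_def act_Fract)
qed

end

theory Submission
  imports Defs "HOL-Algebra.Sylow"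
begin

text \<open>
  Let \<open>L\<close> be the field of rational functions on the copies of the representation, \<open>F\<close> the ground
  field of order \<open>q\<close>, \<open>N\<close> the dimension, \<open>y\<close> the vector of coordinates of the reference copy, and
  \<open>E\<close> the field generated by the given forms. Isometries preserve the forms, so \<open>E\<close> consists of
  invariants. For the converse, \<open>L\<close> is shown to be a Galois extension of \<open>E\<close> whose automorphisms
  are the isometries.

  \<^item> The twists \<open>y ^ (q ^ k)\<close> for \<open>N\<close> consecutive values of \<open>k\<close> form a basis of \<open>L ^ N\<close>, because a
    linearized polynomial of degree less than \<open>q ^ N\<close> cannot vanish on the \<open>F\<close>-span of the
    coordinates of \<open>y\<close> (\<open>det_frob_matrix_nonzero\<close>). The coordinates of every copy are therefore
    determined by the forms and \<open>y\<close>, and the coordinates of \<open>y\<close> generate \<open>L\<close> over \<open>E\<close>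
    (\<open>coordinates_in_subfield\<close>).

  \<^item> In this basis, \<open>y ^ (q ^ N)\<close> has coefficients in \<open>E\<close>, since they solve a linear system made
    from the Gram matrix of the twists (\<open>linear_relation_in_subfield\<close>). The coordinates of \<open>y\<close> are
    thus roots of a linearized polynomial over \<open>E\<close>, whose \<open>q ^ N\<close> roots are exactly their
    \<open>F\<close>-linear combinations (\<open>linearized_poly_factorization\<close>).

  \<^item> An endomorphism of \<open>L\<close> over \<open>E\<close> consequently maps \<open>y\<close> to \<open>y T\<close> with a matrix \<open>T\<close> over \<open>F\<close>.
    It fixes the forms, which makes \<open>T\<close> an isometry (\<open>form_preserving_imp_isometry\<close>), so it is the
    action of \<open>T\<close>.

  An element of \<open>L\<close> fixed by all endomorphisms over \<open>E\<close> lies in \<open>E\<close>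
  (\<open>fixed_by_endomorphisms_in_subfield\<close>), and this proves \<open>fixed_field_isometry_group\<close>. The unitary
  case has the same shape, with the ground field of order \<open>q\<^sup>2\<close> and the second argument of the form
  twisted once more by \<open>q\<close>.

  It remains to see that the Gram matrix has its entries in \<open>E\<close>. By the Frobenius endomorphism and
  the symmetry of the form every entry reduces to pairings of \<open>y\<close> with its twists. In the symplectic
  and unitary cases these are the given generators. In the orthogonal case one pairing is missing;
  it is obtained from a determinant identity that uses that \<open>q\<close> is odd
  (\<open>next_symmetric_form_in_subfield\<close>), and from the nonvanishing of a Gram determinant
  (\<open>det_minor_matrix_coord_vec_nonzero\<close>).
\<close>

section \<open>Subfields and separating functionals\<close>

definition is_subfield :: "'l::field set \<Rightarrow> bool" where
  "is_subfield E \<longleftrightarrow> 1 \<in> E \<and> (\<forall>a\<in>E. \<forall>b\<in>E. a - b \<in> E \<and> a * b \<in> E) \<and> (\<forall>a\<in>E. inverse a \<in> E)"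

context
  fixes E :: "'l::field set"
  assumes E: "is_subfield E"
begin

lemma subfield_1: "1 \<in> E"
  using E by (simp add: is_subfield_def)

lemma subfield_diff: "a \<in> E \<Longrightarrow> b \<in> E \<Longrightarrow> a - b \<in> E"
  using E by (simp add: is_subfield_def)

lemma subfield_mult: "a \<in> E \<Longrightarrow> b \<in> E \<Longrightarrow> a * b \<in> E"
  using E by (simp add: is_subfield_def)

lemma subfield_inverse: "a \<in> E \<Longrightarrow> inverse a \<in> E"
  using E by (simp add: is_subfield_def)

lemma subfield_0: "0 \<in> E"
  using subfield_diff[OF subfield_1 subfield_1] by simp

lemma subfield_uminus: "a \<in> E \<Longrightarrow> - a \<in> E"
  using subfield_diff[OF subfield_0] by simp

lemma subfield_add: "a \<in> E \<Longrightarrow> b \<in> E \<Longrightarrow> a + b \<in> E"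
  using subfield_diff[OF _ subfield_uminus] by force

lemma subfield_divide: "a \<in> E \<Longrightarrow> b \<in> E \<Longrightarrow> a / b \<in> E"
  by (simp add: divide_inverse subfield_mult subfield_inverse)

lemma subfield_power: "a \<in> E \<Longrightarrow> a ^ k \<in> E"
  by (induction k) (simp_all add: subfield_1 subfield_mult)

lemma subfield_sum: "(\<And>i. i \<in> I \<Longrightarrow> g i \<in> E) \<Longrightarrow> sum g I \<in> E"
  by (induction I rule: infinite_finite_induct) (simp_all add: subfield_0 subfield_add)

lemma subfield_prod: "(\<And>i. i \<in> I \<Longrightarrow> g i \<in> E) \<Longrightarrow> prod g I \<in> E"
  by (induction I rule: infinite_finite_induct) (simp_all add: subfield_1 subfield_mult)

end

definition linear_over :: "'l::field set \<Rightarrow> ('l \<Rightarrow> 'l) \<Rightarrow> bool" where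
  "linear_over E l \<longleftrightarrow> (\<forall>a b. l (a + b) = l a + l b) \<and> (\<forall>c\<in>E. \<forall>a. l (c * a) = c * l a)"

text \<open>
  An \<open>E\<close>-subspace that contains \<open>1\<close>, omits \<open>f\<close> and is maximal with these properties is a
  hyperplane complementary to \<open>E f\<close>; the functional is the coordinate along \<open>f\<close>.
\<close>

lemma separating_functional:
  assumes E: "is_subfield E" and f: "f \<notin> E"
  shows "\<exists>l. linear_over E l \<and> l 1 = 0 \<and> l f = 1"
proof -
  define sub where "sub U \<longleftrightarrow> (\<forall>a\<in>U. \<forall>b\<in>U. a + b \<in> U) \<and> (\<forall>c\<in>E. \<forall>a\<in>U. c * a \<in> U)" for U
  let ?A = "{U. sub U \<and> 1 \<in> U \<and> f \<notin> U}"
  have "\<exists>U\<in>?A. \<forall>W\<in>?A. U \<subseteq> W \<longrightarrow> W = U"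
  proof (rule subset_Zorn_nonempty)
    have "sub E" unfolding sub_def using subfield_add[OF E] subfield_mult[OF E] by blast
    then have "E \<in> ?A" using f subfield_1[OF E] by blast
    then show "?A \<noteq> {}" by blast
  next
    fix C assume ne: "C \<noteq> {}" and ch: "subset.chain ?A C"
    then have sub: "sub U" "1 \<in> U" "f \<notin> U" if "U \<in> C" for U
      using that by (auto simp: subset.chain_def)
    have "a + b \<in> \<Union>C" if ab: "a \<in> \<Union>C" "b \<in> \<Union>C" for a b
    proof -
      obtain U W where U: "a \<in> U" "U \<in> C" "b \<in> W" "W \<in> C" using ab by blast
      then have "U \<subseteq> W \<or> W \<subseteq> U" using ch by (auto simp: subset.chain_def)
      then show ?thesis using U sub unfolding sub_def by blast
    qed
    moreover have "c * a \<in> \<Union>C" if "c \<in> E" "a \<in> \<Union>C" for c a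
      using that sub unfolding sub_def by blast
    ultimately have "sub (\<Union>C)" unfolding sub_def by blast
    then show "\<Union>C \<in> ?A" using sub ne by blast
  qed
  then obtain U where U: "sub U" "1 \<in> U" "f \<notin> U"
    and max: "\<And>W. sub W \<Longrightarrow> f \<notin> W \<Longrightarrow> U \<subseteq> W \<Longrightarrow> W = U"
    by blast
  have add: "a + b \<in> U" if "a \<in> U" "b \<in> U" for a b using U(1) that unfolding sub_def by blast
  have scale: "c * a \<in> U" if "c \<in> E" "a \<in> U" for c a using U(1) that unfolding sub_def by blast
  have ex: "\<exists>e\<in>E. a - e * f \<in> U" for a
  proof (cases "a \<in> U")
    case True
    then show ?thesis using subfield_0[OF E] by force
  next
    case False
    \<comment> \<open>By maximality \<open>f\<close> lies in the subspace generated by \<open>U\<close> and \<open>a\<close>.\<close>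
    define W where "W = {u + e * a | u e. u \<in> U \<and> e \<in> E}"
    have "u + 0 * a \<in> W" if "u \<in> U" for u unfolding W_def using that subfield_0[OF E] by blast
    then have 1: "U \<subseteq> W" by auto
    have "0 \<in> U" using scale[OF subfield_0[OF E] U(2)] by simp
    then have "0 + 1 * a \<in> W" unfolding W_def using subfield_1[OF E] by blast
    then have 2: "W \<noteq> U" using False by auto
    have "sub W" unfolding sub_def
    proof (intro conjI ballI)
      fix b c assume "b \<in> W" "c \<in> W"
      then obtain u e u' e' where "b = u + e * a" "c = u' + e' * a" "u \<in> U" "e \<in> E" "u' \<in> U" "e' \<in> E"
        unfolding W_def by blast
      then have "b + c = (u + u') + (e + e') * a" "u + u' \<in> U" "e + e' \<in> E"
        using add subfield_add[OF E] by (auto simp: algebra_simps)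
      then show "b + c \<in> W" unfolding W_def by blast
    next
      fix c b assume c: "c \<in> E" and "b \<in> W"
      then obtain u e where "b = u + e * a" "u \<in> U" "e \<in> E" unfolding W_def by blast
      then have "c * b = c * u + (c * e) * a" "c * u \<in> U" "c * e \<in> E"
        using c scale subfield_mult[OF E] by (auto simp: algebra_simps)
      then show "c * b \<in> W" unfolding W_def by blast
    qed
    then have "f \<in> W" using max 1 2 by blast
    then obtain u e where e: "f = u + e * a" "u \<in> U" "e \<in> E" unfolding W_def by blast
    then have "e \<noteq> 0" using U(3) by auto
    then have "a - inverse e * f = (- inverse e) * u"
      using e(1) by (simp add: field_simps)
    moreover have "(- inverse e) * u \<in> U"
      using e subfield_inverse[OF E] subfield_uminus[OF E] scale by blast
    ultimately show ?thesis using subfield_inverse[OF E e(3)] by force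
  qed
  have uniq: "e = e'" if "e \<in> E" "e' \<in> E" "a - e * f \<in> U" "a - e' * f \<in> U" for a e e'
  proof (rule ccontr)
    assume ne: "e \<noteq> e'"
    have "(a - e' * f) + (- 1) * (a - e * f) \<in> U"
      using that add scale subfield_uminus[OF E subfield_1[OF E]] by blast
    then have "(e - e') * f \<in> U" by (simp add: algebra_simps)
    then have "inverse (e - e') * ((e - e') * f) \<in> U"
      using scale subfield_inverse[OF E] subfield_diff[OF E] that by blast
    then show False using U(3) ne by (simp add: mult.assoc[symmetric])
  qed
  \<comment> \<open>Every element is congruent modulo \<open>U\<close> to a unique \<open>E\<close>-multiple of \<open>f\<close>.\<close>
  define l where "l a = (SOME e. e \<in> E \<and> a - e * f \<in> U)" for a
  have l: "l a \<in> E" "a - l a * f \<in> U" for a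
    using someI_ex[of "\<lambda>e. e \<in> E \<and> a - e * f \<in> U"] ex[of a] unfolding l_def by blast+
  have l_eq: "l a = e" if "e \<in> E" "a - e * f \<in> U" for a e
    using uniq that l by blast
  have "linear_over E l" unfolding linear_over_def
  proof (intro conjI ballI allI)
    fix a b
    have "(a + b) - (l a + l b) * f = (a - l a * f) + (b - l b * f)" by (simp add: algebra_simps)
    then show "l (a + b) = l a + l b"
      using l_eq add l subfield_add[OF E] by metis
  next
    fix c a assume c: "c \<in> E"
    have "c * a - (c * l a) * f = c * (a - l a * f)" by (simp add: algebra_simps)
    then show "l (c * a) = c * l a"
      using l_eq scale l c subfield_mult[OF E] by metis
  qed
  moreover have "l 1 = 0" using l_eq U(2) subfield_0[OF E] by simp
  moreover have "0 \<in> U" using scale[OF subfield_0[OF E] U(2)] by simp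
  then have "l f = 1" using l_eq subfield_1[OF E] by simp
  ultimately show ?thesis by blast
qed

section \<open>Galois descent by eigenvectors of multiplications\<close>

definition function_space :: "('l \<Rightarrow> 'l::field) set \<Rightarrow> bool" where
  "function_space S \<longleftrightarrow> (\<lambda>a. 0) \<in> S \<and> (\<forall>\<xi>\<in>S. \<forall>\<eta>\<in>S. \<forall>c. (\<lambda>a. \<xi> a + c * \<eta> a) \<in> S)"

lemma function_space_add_scale:
  "function_space S \<Longrightarrow> \<xi> \<in> S \<Longrightarrow> \<eta> \<in> S \<Longrightarrow> (\<lambda>a. \<xi> a + c * \<eta> a) \<in> S"
  by (simp add: function_space_def)

lemma function_space_scale:
  assumes "function_space S" "\<eta> \<in> S" shows "(\<lambda>a. c * \<eta> a) \<in> S"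
  using function_space_add_scale[OF assms(1) _ assms(2), of "\<lambda>a. 0" c] assms(1)
  by (simp add: function_space_def)

text \<open>
  Multiplication of the argument by \<open>x\<close> is a linear operator on functions \<open>L \<Rightarrow> L\<close>;
  \<open>poly_shift p x\<close> is the polynomial \<open>p\<close> in that operator.
\<close>

definition poly_shift :: "'l::field poly \<Rightarrow> 'l \<Rightarrow> ('l \<Rightarrow> 'l) \<Rightarrow> 'l \<Rightarrow> 'l" where
  "poly_shift p x \<xi> a = (\<Sum>i\<le>Polynomial.degree p. poly.coeff p i * \<xi> (x ^ i * a))"

lemma poly_shift_bound:
  assumes "Polynomial.degree p \<le> n"
  shows "poly_shift p x \<xi> a = (\<Sum>i\<le>n. poly.coeff p i * \<xi> (x ^ i * a))"
  unfolding poly_shift_def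
  by (rule sum.mono_neutral_left) (use assms in \<open>auto simp: coeff_eq_0\<close>)

lemma poly_shift_linear_factor:
  "poly_shift ([:- u, 1:] * p) x \<xi> a = poly_shift p x (\<lambda>a. \<xi> (x * a) - u * \<xi> a) a"
proof -
  let ?n = "Polynomial.degree p"
  have deg: "Polynomial.degree ([:- u, 1:] * p) \<le> Suc ?n"
    using degree_mult_le[of "[:- u, 1:]" p] by simp
  have c0: "poly.coeff p (Suc ?n) = 0" by (simp add: coeff_eq_0)
  have "poly_shift ([:- u, 1:] * p) x \<xi> a =
      (\<Sum>i\<le>Suc ?n. (poly.coeff (pCons 0 p) i - u * poly.coeff p i) * \<xi> (x ^ i * a))"
    unfolding poly_shift_bound[OF deg] by simp
  also have "\<dots> = (\<Sum>i\<le>Suc ?n. poly.coeff (pCons 0 p) i * \<xi> (x ^ i * a)) -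
      (\<Sum>i\<le>Suc ?n. u * poly.coeff p i * \<xi> (x ^ i * a))"
    by (simp only: left_diff_distrib sum_subtractf)
  also have "(\<Sum>i\<le>Suc ?n. poly.coeff (pCons 0 p) i * \<xi> (x ^ i * a)) =
      (\<Sum>i\<le>?n. poly.coeff p i * \<xi> (x ^ Suc i * a))"
    by (subst sum.atMost_Suc_shift) simp
  also have "(\<Sum>i\<le>Suc ?n. u * poly.coeff p i * \<xi> (x ^ i * a)) =
      (\<Sum>i\<le>?n. u * poly.coeff p i * \<xi> (x ^ i * a))"
    using c0 by simp
  finally show ?thesis
    unfolding poly_shift_def by (simp add: algebra_simps sum_subtractf)
qed

text \<open>
  An operator annihilated by a polynomial with distinct roots is diagonalizable. The subspace \<open>S\<close>
  stands for the span of the eigenvectors. In the induction step the operator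
  \<open>T = (\<cdot> x) - u\<close> is invertible on the eigenvectors for \<open>v \<noteq> u\<close>, so the induction hypothesis,
  used for the space \<open>T ` (C \<inter> S)\<close>, makes the given function an element of \<open>S\<close> up to the kernel of \<open>T\<close>.
\<close>

lemma eigenvectors_span:
  assumes "finite V"
    and C: "function_space C" "\<And>\<xi>. \<xi> \<in> C \<Longrightarrow> (\<lambda>a. \<xi> (x * a)) \<in> C"
    and "function_space S"
    and "\<And>v \<xi>. v \<in> V \<Longrightarrow> \<xi> \<in> C \<Longrightarrow> (\<And>a. \<xi> (x * a) = v * \<xi> a) \<Longrightarrow> \<xi> \<in> S"
    and "\<kappa> \<in> C" "\<And>a. poly_shift (\<Prod>v\<in>V. [:- v, 1:]) x \<kappa> a = 0"
  shows "\<kappa> \<in> S"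
  using assms(1,4-)
proof (induction V arbitrary: S \<kappa> rule: finite_induct)
  case empty
  then have "\<kappa> = (\<lambda>a. 0)" by (simp add: poly_shift_def fun_eq_iff)
  then show ?case using empty by (simp add: function_space_def)
next
  case (insert u V)
  define T where "T \<eta> = (\<lambda>a. \<eta> (x * a) - u * \<eta> a)" for \<eta> :: "'a \<Rightarrow> 'a"
  have T_add: "T (\<lambda>a. \<xi> a + c * \<eta> a) = (\<lambda>a. T \<xi> a + c * T \<eta> a)" for \<xi> \<eta> c
    by (simp add: T_def algebra_simps)
  define S' where "S' = T ` (C \<inter> S)"
  have "T \<kappa> = (\<lambda>a. \<kappa> (x * a) + (- u) * \<kappa> a)" by (simp add: T_def)
  then have TC: "T \<kappa> \<in> C"
    using function_space_add_scale[OF C(1) C(2)] insert.prems(3) by metis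
  have CS: "function_space (C \<inter> S)"
    using C(1) insert.prems(1) by (auto simp: function_space_def)
  have "T \<kappa> \<in> S'"
  proof (rule insert.IH)
    show "function_space S'" unfolding function_space_def
    proof (intro conjI ballI allI)
      have "(\<lambda>a. 0) = T (\<lambda>a. 0)" by (simp add: T_def)
      moreover have "(\<lambda>a. 0) \<in> C \<inter> S" using CS by (simp add: function_space_def)
      ultimately show "(\<lambda>a. 0) \<in> S'" unfolding S'_def by blast
      fix \<xi> \<eta> c assume "\<xi> \<in> S'" "\<eta> \<in> S'"
      then obtain \<xi>' \<eta>' where *: "\<xi> = T \<xi>'" "\<eta> = T \<eta>'" "\<xi>' \<in> C \<inter> S" "\<eta>' \<in> C \<inter> S"
        unfolding S'_def by blast
      show "(\<lambda>a. \<xi> a + c * \<eta> a) \<in> S'"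
        unfolding S'_def *(1,2) T_add[symmetric]
        using function_space_add_scale[OF CS *(3,4)] by blast
    qed
  next
    fix v \<xi> assume v: "v \<in> V" and \<xi>: "\<xi> \<in> C" and eig: "\<And>a. \<xi> (x * a) = v * \<xi> a"
    have "v \<noteq> u" using v insert.hyps by blast
    then have "\<xi> = T (\<lambda>a. inverse (v - u) * \<xi> a)"
      by (simp add: T_def fun_eq_iff eig right_diff_distrib[symmetric] left_diff_distrib[symmetric]
          mult.left_commute[of v] mult.left_commute[of u])
    moreover have "\<xi> \<in> S" using insert.prems(2) v \<xi> eig by blast
    then have "(\<lambda>a. inverse (v - u) * \<xi> a) \<in> C \<inter> S"
      using function_space_scale[OF CS] \<xi> by blast
    ultimately show "\<xi> \<in> S'" unfolding S'_def by blast
  next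
    show "T \<kappa> \<in> C" by (fact TC)
    show "poly_shift (\<Prod>v\<in>V. [:- v, 1:]) x (T \<kappa>) a = 0" for a
      using insert.prems(4)[of a] insert.hyps
      by (simp only: prod.insert poly_shift_linear_factor T_def not_False_eq_True)
  qed
  then obtain \<eta> where \<eta>: "\<eta> \<in> C" "\<eta> \<in> S" "T \<kappa> = T \<eta>" unfolding S'_def by blast
  define \<delta> where "\<delta> = (\<lambda>a. \<kappa> a + (- 1) * \<eta> a)"
  have "\<delta> (x * a) = u * \<delta> a" for a
    using fun_cong[OF \<eta>(3), of a] by (simp add: T_def \<delta>_def algebra_simps)
  moreover have "\<delta> \<in> C" unfolding \<delta>_def
    using function_space_add_scale[OF C(1) insert.prems(3) \<eta>(1)] by blast
  ultimately have "\<delta> \<in> S" using insert.prems(2) by blast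
  from function_space_add_scale[OF insert.prems(1) this \<eta>(2), of 1]
  show ?case by (simp add: \<delta>_def)
qed

text \<open>
  Multiplications commute, so each eigenspace of one of them is stable under the others and the
  decomposition can be refined one generator at a time.
\<close>

lemma joint_eigenvectors_span:
  assumes "finite A"
    and fin: "\<And>x. x \<in> A \<Longrightarrow> finite (V x)"
    and S: "function_space S"
    and "function_space C" "\<And>x \<xi>. \<xi> \<in> C \<Longrightarrow> (\<lambda>a. \<xi> (x * a)) \<in> C"
    and "\<And>x \<xi> a. x \<in> A \<Longrightarrow> \<xi> \<in> C \<Longrightarrow> poly_shift (\<Prod>v\<in>V x. [:- v, 1:]) x \<xi> a = 0"
    and "\<And>\<xi>. \<xi> \<in> C \<Longrightarrow> (\<And>x. x \<in> A \<Longrightarrow> \<exists>v\<in>V x. \<forall>a. \<xi> (x * a) = v * \<xi> a) \<Longrightarrow> \<xi> \<in> S"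
  shows "C \<subseteq> S"
  using assms(1,2,4-)
proof (induction A arbitrary: C rule: finite_induct)
  case empty
  then show ?case by blast
next
  case (insert x A)
  show ?case
  proof
    fix \<kappa> assume \<kappa>: "\<kappa> \<in> C"
    show "\<kappa> \<in> S"
    proof (rule eigenvectors_span[where x = x and V = "V x" and C = C])
      fix v \<xi> assume v: "v \<in> V x" and \<xi>: "\<xi> \<in> C" "\<And>a. \<xi> (x * a) = v * \<xi> a"
      define C' where "C' = {\<xi> \<in> C. \<forall>a. \<xi> (x * a) = v * \<xi> a}"
      have "C' \<subseteq> S"
      proof (rule insert.IH)
        show "function_space C'"
          using insert.prems(2) unfolding C'_def function_space_def by (simp add: algebra_simps)
        show "(\<lambda>a. \<xi> (y * a)) \<in> C'" if "\<xi> \<in> C'" for y \<xi>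
          using that insert.prems(3) unfolding C'_def by (simp add: mult.left_commute[of y])
        show "\<xi> \<in> S" if "\<xi> \<in> C'" "\<And>y. y \<in> A \<Longrightarrow> \<exists>v\<in>V y. \<forall>a. \<xi> (y * a) = v * \<xi> a" for \<xi>
          using that v insert.prems(5) unfolding C'_def by blast
      qed (use insert.prems in \<open>auto simp: C'_def\<close>)
      then show "\<xi> \<in> S" using \<xi> by (auto simp: C'_def)
    qed (use insert.prems S \<kappa> in auto)
  qed
qed

definition field_endomorphism :: "('l::field \<Rightarrow> 'l) \<Rightarrow> bool" where
  "field_endomorphism \<sigma> \<longleftrightarrow> \<sigma> 1 = 1 \<and> (\<forall>a b. \<sigma> (a + b) = \<sigma> a + \<sigma> b \<and> \<sigma> (a * b) = \<sigma> a * \<sigma> b)"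

text \<open>
  The elements \<open>a\<close> for which \<open>\<xi> (a c)\<close> is a constant multiple of \<open>\<xi> c\<close> form a subfield, hence the
  whole field as soon as they include generators. The multiplier then depends on \<open>a\<close> additively
  and multiplicatively.
\<close>

lemma eigenvector_endomorphism:
  assumes E: "is_subfield E"
    and gen: "\<And>D. is_subfield D \<Longrightarrow> E \<subseteq> D \<Longrightarrow> A \<subseteq> D \<Longrightarrow> D = UNIV"
    and lin: "linear_over E \<xi>" and nz: "\<xi> b \<noteq> 0"
    and eig: "\<And>x. x \<in> A \<Longrightarrow> \<exists>v\<in>V x. \<forall>a. \<xi> (x * a) = v * \<xi> a"
  shows "\<exists>\<sigma>. field_endomorphism \<sigma> \<and> (\<forall>c\<in>E. \<sigma> c = c) \<and> (\<forall>x\<in>A. \<sigma> x \<in> V x) \<and>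
    (\<forall>a c. \<xi> (a * c) = \<sigma> a * \<xi> c)"
proof -
  have add: "\<xi> (a + b) = \<xi> a + \<xi> b" for a b using lin by (simp add: linear_over_def)
  have scale: "\<xi> (c * a) = c * \<xi> a" if "c \<in> E" for a c using lin that by (simp add: linear_over_def)
  have diff: "\<xi> (a - b) = \<xi> a - \<xi> b" for a b using add[of "a - b" b] by simp
  define D where "D = {a. \<exists>y. \<forall>c. \<xi> (a * c) = y * \<xi> c}"
  have inv: "inverse a \<in> D" if aD: "a \<in> D" for a
  proof (cases "a = 0")
    case True
    then show ?thesis using aD by simp
  next
    case False
    obtain y where y: "\<xi> (a * c) = y * \<xi> c" for c using aD by (auto simp: D_def)
    have y': "\<xi> c = y * \<xi> (inverse a * c)" for c
      using y[of "inverse a * c"] False by (simp add: mult.assoc[symmetric] del: mult.assoc)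
    then have "y \<noteq> 0" using nz by (metis mult_zero_left)
    then have "\<xi> (inverse a * c) = inverse y * \<xi> c" for c
      using y'[of c] by simp
    then show ?thesis by (auto simp: D_def)
  qed
  have "is_subfield D" unfolding is_subfield_def
  proof (intro conjI ballI inv)
    show "1 \<in> D" unfolding D_def by (auto intro: exI[of _ 1])
    fix a b assume "a \<in> D" "b \<in> D"
    then obtain y z where yz: "\<And>c. \<xi> (a * c) = y * \<xi> c" "\<And>c. \<xi> (b * c) = z * \<xi> c"
      by (auto simp: D_def)
    have "\<xi> ((a - b) * c) = (y - z) * \<xi> c" for c
      by (simp add: left_diff_distrib diff yz)
    then show "a - b \<in> D" by (auto simp: D_def)
    have "\<xi> ((a * b) * c) = (y * z) * \<xi> c" for c
      by (simp add: mult.assoc yz)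
    then show "a * b \<in> D" by (auto simp: D_def)
  qed
  moreover have "E \<subseteq> D" unfolding D_def using scale by blast
  moreover have "A \<subseteq> D" unfolding D_def using eig by blast
  ultimately have "D = UNIV" by (rule gen)
  then have "\<forall>a. \<exists>y. \<forall>c. \<xi> (a * c) = y * \<xi> c" unfolding D_def by blast
  then obtain \<sigma> where \<sigma>: "\<And>a c. \<xi> (a * c) = \<sigma> a * \<xi> c" by metis
  have uniq: "\<sigma> a = y" if "\<xi> (a * b) = y * \<xi> b" for a y
    using that \<sigma>[of a b] nz by simp
  have "field_endomorphism \<sigma>" unfolding field_endomorphism_def
  proof (intro conjI allI)
    show "\<sigma> 1 = 1" by (rule uniq) simp
    show "\<sigma> (a + c) = \<sigma> a + \<sigma> c" for a c
      by (rule uniq) (simp add: distrib_right add \<sigma>)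
    show "\<sigma> (a * c) = \<sigma> a * \<sigma> c" for a c
      by (rule uniq) (simp add: mult.assoc \<sigma>)
  qed
  moreover have "\<forall>c\<in>E. \<sigma> c = c" using uniq scale by blast
  moreover have "\<forall>x\<in>A. \<sigma> x \<in> V x" using uniq eig by metis
  ultimately show ?thesis using \<sigma> by blast
qed

text \<open>
  The part of Galois theory that the main theorem rests on. The field is generated over \<open>E\<close> by \<open>A\<close>,
  and every \<open>x \<in> A\<close> is a root of a polynomial over \<open>E\<close> with the distinct roots \<open>V x\<close>.

  If \<open>f \<notin> E\<close>, some \<open>E\<close>-linear functional \<open>l\<close> satisfies \<open>l 1 = 0\<close> and \<open>l f = 1\<close>. The polynomial of
  \<open>x\<close> has coefficients in \<open>E\<close>, which pass through \<open>l\<close>, so it annihilates multiplication by \<open>x\<close> on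
  functionals, and \<open>l\<close> is a combination of joint eigenvectors. A nonzero joint eigenvector \<open>\<xi>\<close> belongs
  to an endomorphism \<open>\<sigma>\<close> over \<open>E\<close>, and \<open>\<xi> f = \<sigma> f * \<xi> 1 = f * \<xi> 1\<close>. By linearity \<open>l f = f * l 1\<close>,
  a contradiction.
\<close>

theorem fixed_by_endomorphisms_in_subfield:
  assumes E: "is_subfield E" and A: "finite A"
    and gen: "\<And>D. is_subfield D \<Longrightarrow> E \<subseteq> D \<Longrightarrow> A \<subseteq> D \<Longrightarrow> D = UNIV"
    and V: "\<And>x. x \<in> A \<Longrightarrow> finite (V x)" "\<And>x. x \<in> A \<Longrightarrow> x \<in> V x"
    and coeff: "\<And>x i. x \<in> A \<Longrightarrow> poly.coeff (\<Prod>v\<in>V x. [:- v, 1:]) i \<in> E"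
    and fixed: "\<And>\<sigma>. field_endomorphism \<sigma> \<Longrightarrow> (\<And>c. c \<in> E \<Longrightarrow> \<sigma> c = c) \<Longrightarrow>
      (\<And>x. x \<in> A \<Longrightarrow> \<sigma> x \<in> V x) \<Longrightarrow> \<sigma> f = f"
  shows "f \<in> E"
proof (rule ccontr)
  assume "f \<notin> E"
  then obtain l where l: "linear_over E l" "l 1 = 0" "l f = 1"
    using separating_functional[OF E] by blast
  define S where "S = {\<xi>. \<xi> f = f * \<xi> 1}"
  have "Collect (linear_over E) \<subseteq> S"
  proof (rule joint_eigenvectors_span[where V = V, OF A])
    show "function_space S"
      by (auto simp: S_def function_space_def algebra_simps)
    show "function_space (Collect (linear_over E))"
      by (auto simp: function_space_def linear_over_def algebra_simps)
    show "(\<lambda>a. \<xi> (x * a)) \<in> Collect (linear_over E)" if "\<xi> \<in> Collect (linear_over E)" for x \<xi>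
      using that by (auto simp: linear_over_def distrib_left mult.left_commute[of x])
  next
    fix x \<xi> a assume x: "x \<in> A" and "\<xi> \<in> Collect (linear_over E)"
    then have add: "\<xi> (b + c) = \<xi> b + \<xi> c" and scale: "c \<in> E \<Longrightarrow> \<xi> (c * b) = c * \<xi> b" for b c
      by (simp_all add: linear_over_def)
    have \<xi>0: "\<xi> 0 = 0" using add[of 0 0] by (metis add_0_left add_cancel_right_left)
    have sum: "\<xi> (sum g I) = (\<Sum>i\<in>I. \<xi> (g i))" for g and I :: "nat set"
      by (induction I rule: infinite_finite_induct) (simp_all add: \<xi>0 add)
    let ?p = "\<Prod>v\<in>V x. [:- v, 1:]"
    have "poly_shift ?p x \<xi> a = \<xi> (\<Sum>i\<le>Polynomial.degree ?p. poly.coeff ?p i * (x ^ i * a))"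
      unfolding poly_shift_def sum using scale coeff[OF x] by simp
    also have "(\<Sum>i\<le>Polynomial.degree ?p. poly.coeff ?p i * (x ^ i * a)) = poly ?p x * a"
      by (simp only: poly_altdef sum_distrib_right mult.assoc)
    also have "poly ?p x = 0"
      unfolding poly_prod using V[OF x] by (intro prod_zero) auto
    finally show "poly_shift ?p x \<xi> a = 0" by (simp add: \<xi>0)
  next
    fix \<xi> assume \<xi>: "\<xi> \<in> Collect (linear_over E)"
      and eig: "\<And>x. x \<in> A \<Longrightarrow> \<exists>v\<in>V x. \<forall>a. \<xi> (x * a) = v * \<xi> a"
    show "\<xi> \<in> S"
    proof (cases "\<exists>b. \<xi> b \<noteq> 0")
      case True
      then obtain b where "\<xi> b \<noteq> 0" by blast
      from eigenvector_endomorphism[where V = V, OF E gen _ this eig] \<xi>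
      obtain \<sigma> where "field_endomorphism \<sigma>" "\<forall>c\<in>E. \<sigma> c = c" "\<forall>x\<in>A. \<sigma> x \<in> V x"
        and \<sigma>: "\<xi> (a * c) = \<sigma> a * \<xi> c" for a c
        by blast
      then have "\<sigma> f = f" using fixed by blast
      then show ?thesis using \<sigma>[of f 1] by (simp add: S_def)
    qed (simp add: S_def)
  qed (use V in auto)
  then have "l f = f * l 1" using l(1) by (auto simp: S_def)
  then show False using l by simp
qed

section \<open>Finite fields\<close>

lemma power_card_finite_field: "x ^ CARD('a) = (x :: 'a::{field,finite})"
proof (cases "x = 0")
  case False
  let ?U = "UNIV - {0 :: 'a}"
  have "(\<Prod>y\<in>?U. y) = (\<Prod>y\<in>?U. x * y)"
    by (rule prod.reindex_bij_witness[of _ "\<lambda>y. x * y" "\<lambda>y. y / x"]) (use False in auto)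
  also have "\<dots> = x ^ card ?U * (\<Prod>y\<in>?U. y)"
    by (simp add: prod.distrib)
  finally have "x ^ card ?U = 1"
    by simp
  moreover have "CARD('a) = Suc (card ?U)"
    using card.remove[of "UNIV :: 'a set" 0] by simp
  ultimately show ?thesis by (simp only: power_Suc mult_1_right)
qed (simp add: power_0_left)

text \<open>
  By Sylow's theorem any prime \<open>l\<close> dividing the order occurs as the order of a subgroup of the
  additive group, whose nonzero elements are annihilated by \<open>l\<close>; hence \<open>l\<close> is the characteristic.
\<close>

lemma card_finite_field_eq_CHAR_power: "\<exists>e. CARD('a::{field,finite}) = CHAR('a) ^ e"
proof -
  let ?p = "CHAR('a)"
  have p: "Factorial_Ring.prime ?p"
    using prime_CHAR_semidom[where 'a = 'a] finite_imp_CHAR_pos[where 'a = 'a] by simp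
  obtain m where m: "CARD('a) = ?p ^ multiplicity ?p CARD('a) * m" "\<not> ?p dvd m"
    using multiplicity_decompose'[of "CARD('a)" ?p] p
    by (metis finite_UNIV_card_ge_0 finite not_prime_unit neq0_conv)
  have "m = 1"
  proof (rule ccontr)
    assume "m \<noteq> 1"
    then obtain l where l: "Factorial_Ring.prime l" "l dvd m"
      using prime_factor_nat by blast
    then have l_ne: "l \<noteq> ?p" using m(2) by blast
    obtain m' where m': "CARD('a) = l ^ 1 * m'"
      using l(2) m(1) by (metis dvd_def dvd_mult power_one_right)
    define G where "G = \<lparr>carrier = UNIV :: 'a set, monoid.mult = (+), one = (0::'a)\<rparr>"
    have G: "group G"
      by (rule groupI) (auto simp: G_def add.assoc intro: exI[of _ "- _"] left_minus)
    then interpret group G .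
    have "order G = l ^ 1 * m'" "finite (carrier G)"
      by (simp_all add: G_def order_def m')
    then obtain B where B: "subgroup B G" "card B = l ^ 1"
      using sylow_thm[OF l(1) G] by blast
    have "card B > 1" using B l(1) prime_gt_1_nat by simp
    then have "\<not> B \<subseteq> {0}"
      using card_mono[of "{0}" B] by force
    then obtain x where x: "x \<in> B" "x \<noteq> 0" by blast
    interpret B: group "G\<lparr>carrier := B\<rparr>"
      using B(1) G by (rule subgroup.subgroup_is_group)
    have "x [^]\<^bsub>G\<lparr>carrier := B\<rparr>\<^esub> order (G\<lparr>carrier := B\<rparr>) = \<one>\<^bsub>G\<lparr>carrier := B\<rparr>\<^esub>"
      by (rule B.pow_order_eq_1) (use x in \<open>auto simp: G_def\<close>)
    moreover have "x [^]\<^bsub>G\<lparr>carrier := B\<rparr>\<^esub> k = of_nat k * x" for k :: nat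
      by (induction k) (simp_all add: G_def algebra_simps)
    ultimately have "of_nat l * x = 0"
      using B(2) by (simp add: order_def G_def)
    then have "?p dvd l"
      using x(2) by (simp add: of_nat_eq_0_iff_char_dvd)
    then show False
      using l_ne p l(1) primes_dvd_imp_eq by blast
  qed
  then show ?thesis using m(1) by auto
qed

section \<open>Determinants, and matrices with numbered columns\<close>

lemma det_eq_0_kernel:
  fixes A :: "'l::field ^ 'n ^ 'n"
  assumes "det A = 0"
  obtains c where "A *v c = 0" "c \<noteq> 0"
  using assms invertible_det_nz[of A] invertible_left_inverse[of A] matrix_left_invertible_ker[of A]
  by blast

lemma det_in_subfield:
  fixes A :: "'l::field ^ 'n ^ 'n"
  assumes E: "is_subfield E" and A: "\<And>i j. A $ i $ j \<in> E"
  shows "det A \<in> E"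
proof -
  have "of_int (sign p) \<in> E" for p :: "'n \<Rightarrow> 'n"
    using subfield_1[OF E] subfield_uminus[OF E] by (simp add: sign_def)
  then show ?thesis
    unfolding det_def
    by (intro subfield_sum[OF E] subfield_mult[OF E] subfield_prod[OF E] A)
qed

text \<open>
  Cramer's rule expresses the solution by determinants of matrices with entries in \<open>E\<close>.
\<close>

lemma linear_system_solution_in_subfield:
  fixes A :: "'l::field ^ 'n ^ 'n"
  assumes E: "is_subfield E" and A: "\<And>i j. A $ i $ j \<in> E" and nz: "det A \<noteq> 0"
    and b: "\<And>i. (A *v z) $ i \<in> E"
  shows "z $ k \<in> E"
proof -
  have "z $ k * det A \<in> E"
    unfolding cramer_lemma[symmetric] by (rule det_in_subfield[OF E]) (simp add: A b)
  then have "(z $ k * det A) / det A \<in> E"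
    by (rule subfield_divide[OF E]) (rule det_in_subfield[OF E A])
  then show ?thesis using nz by simp
qed

lemma transpose_nth: "transpose A $ i $ j = A $ j $ i"
  by (simp add: transpose_def)

lemma det_map_matrix_hom:
  fixes h :: "'r::comm_ring_1 \<Rightarrow> 's::comm_ring_1" and A :: "'r ^ 'n ^ 'n::finite"
  assumes one: "h 1 = 1" and add: "\<And>a b. h (a + b) = h a + h b"
    and mult: "\<And>a b. h (a * b) = h a * h b"
  shows "det (map_matrix h A) = h (det A)"
proof -
  have zero: "h 0 = 0" using add[of 0 0] by (metis add_0_left add_cancel_right_left)
  have sum: "h (sum f I) = (\<Sum>i\<in>I. h (f i))" for f and I :: "('n \<Rightarrow> 'n) set"
    by (induction I rule: infinite_finite_induct) (simp_all add: zero add)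
  have prod: "h (prod f I) = (\<Prod>i\<in>I. h (f i))" for f and I :: "'n set"
    by (induction I rule: infinite_finite_induct) (simp_all add: one mult)
  have "h (- 1) = - 1" using add[of "- 1" 1] by (simp add: zero one eq_neg_iff_add_eq_0)
  then have "h (of_int (sign p)) = of_int (sign p)" for p :: "'n \<Rightarrow> 'n"
    by (simp add: sign_def one)
  then show ?thesis by (simp add: det_def sum mult prod)
qed

lemma det_replace_row:
  fixes G :: "'r::comm_ring_1 ^ 'n ^ 'n::finite"
  shows "det G = det (\<chi> i. if i = a then G $ a - G $ a $ b *s axis b 1 else G $ i) +
    G $ a $ b * det (\<chi> i. if i = a then axis b 1 else G $ i)"
proof -
  have "det G = det (\<chi> i. if i = a then (G $ a - G $ a $ b *s axis b 1) + G $ a $ b *s axis b 1 else G $ i)"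
    by (rule arg_cong[of _ _ det]) (simp add: vec_eq_iff)
  then show ?thesis by (simp only: det_row_add det_row_mul)
qed

text \<open>
  Columns of a square matrix will be attached to exponents \<open>0, \<dots>, N - 1\<close>, so the index type is
  numbered by an arbitrary bijection.
\<close>

definition index :: "'n::finite \<Rightarrow> nat" where
  "index = (SOME f. bij_betw f UNIV {..<CARD('n)})"

lemma bij_index: "bij_betw (index :: 'n::finite \<Rightarrow> nat) UNIV {..<CARD('n)}"
  unfolding index_def
  using ex_bij_betw_finite_nat[of "UNIV :: 'n set"]
  by (intro someI_ex[where P = "\<lambda>f. bij_betw f UNIV {..<CARD('n)}"]) (simp add: atLeast0LessThan)

lemma index_less: "index (k :: 'n::finite) < CARD('n)"
  using bij_index bij_betwE by blast

lemma sum_index: "(\<Sum>k\<in>UNIV. g (index (k :: 'n::finite))) = (\<Sum>k<CARD('n). g k)"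
  using sum.reindex_bij_betw[OF bij_index] .

lemma index_surj: "k < CARD('n) \<Longrightarrow> \<exists>i::'n::finite. index i = k"
  using bij_index[where 'n = 'n] unfolding bij_betw_def by (metis imageE lessThan_iff)

lemma index_eq_iff: "index i = index j \<longleftrightarrow> i = j" for i j :: "'n::finite"
  using bij_index[where 'n = 'n] by (auto simp: bij_betw_def inj_eq)

lemma inv_into_index: "inv_into UNIV index (index k) = k" for k :: "'n::finite"
  using bij_index[where 'n = 'n] by (simp add: bij_betw_def)

lemma index_endpoints:
  obtains i0 i1 :: "'n::finite" where "index i0 = 0" "Suc (index i1) = CARD('n)"
proof -
  obtain i0 i1 :: 'n where "index i0 = 0" "index i1 = CARD('n) - 1"
    using index_surj[of 0, where 'n = 'n] index_surj[of "CARD('n) - 1", where 'n = 'n] by auto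
  moreover have "Suc (CARD('n) - 1) = CARD('n)" using zero_less_card_finite[where 'a = 'n] by linarith
  ultimately show ?thesis using that[of i0 i1] by simp
qed

section \<open>Linearized polynomials over an extension of a finite field\<close>

definition vpow :: "'l::field ^ 'n \<Rightarrow> nat \<Rightarrow> 'l ^ 'n::finite" where
  "vpow y e = (\<chi> j. (y $ j) ^ e)"

lemma vpow_nth [simp]: "vpow y e $ j = (y $ j) ^ e"
  by (simp add: vpow_def)

lemma vpow_vpow: "vpow (vpow y d) e = vpow y (d * e)"
  by (simp add: vec_eq_iff power_mult)

lemma vpow_1 [simp]: "vpow y (Suc 0) = y"
  by (simp add: vec_eq_iff)

locale finite_field_embedding =
  fixes emb :: "'a::{field,finite} \<Rightarrow> 'l::field"
  assumes emb_1 [simp]: "emb 1 = 1"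
    and emb_add: "emb (a + b) = emb a + emb b"
    and emb_mult: "emb (a * b) = emb a * emb b"
begin

lemma emb_0 [simp]: "emb 0 = 0"
  using emb_add[of 0 0] by (metis add_0_left add_cancel_right_left)

lemma emb_uminus: "emb (- a) = - emb a"
  using emb_add[of "- a" a] by (simp add: eq_neg_iff_add_eq_0)

lemma emb_diff: "emb (a - b) = emb a - emb b"
  using emb_add[of a "- b"] by (simp add: emb_uminus)

lemma emb_sum: "emb (sum f I) = (\<Sum>i\<in>I. emb (f i))"
  by (induction I rule: infinite_finite_induct) (simp_all add: emb_add)

lemma emb_power: "emb (a ^ k) = emb a ^ k"
  by (induction k) (simp_all add: emb_mult)

lemma emb_eq_0_iff [simp]: "emb a = 0 \<longleftrightarrow> a = 0"
proof
  show "a = 0" if "emb a = 0"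
  proof (rule ccontr)
    assume "a \<noteq> 0"
    then have "emb (a * inverse a) = 1" by simp
    with that show False by (simp only: emb_mult mult_zero_left zero_neq_one)
  qed
qed simp

lemma CHAR_eq: "CHAR('l) = CHAR('a)"
proof -
  have "emb (of_nat k) = of_nat k" for k by (induction k) (simp_all add: emb_add)
  then show ?thesis
    by (intro CHAR_eqI) (metis emb_0 of_nat_CHAR, metis emb_eq_0_iff of_nat_eq_0_iff_char_dvd)
qed

text \<open>
  The exponents \<open>r\<close> for which \<open>y \<mapsto> y ^ r\<close> is a power of the Frobenius endomorphism.
\<close>

definition char_power :: "nat \<Rightarrow> bool" where
  "char_power r \<longleftrightarrow> (\<exists>e. r = CHAR('a) ^ e)"

lemma prime_CHAR: "Factorial_Ring.prime CHAR('a)"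
  using prime_CHAR_semidom[where 'a = 'a] finite_imp_CHAR_pos[where 'a = 'a] by simp

lemma char_power_1: "char_power 1"
  unfolding char_power_def by (metis power_0)

lemma char_power_card: "char_power CARD('a)"
  unfolding char_power_def by (rule card_finite_field_eq_CHAR_power)

lemma char_power_mult: "char_power r \<Longrightarrow> char_power s \<Longrightarrow> char_power (r * s)"
  unfolding char_power_def by (metis power_add)

lemma char_power_power: "char_power r \<Longrightarrow> char_power (r ^ k)"
  unfolding char_power_def by (metis power_mult)

lemma char_power_mult_card_power: "char_power r \<Longrightarrow> char_power (r * CARD('a) ^ k)"
  by (intro char_power_mult char_power_power char_power_card)

lemma power_sum:
  assumes "char_power r"
  shows "sum f I ^ r = (\<Sum>i\<in>I. (f i :: 'l) ^ r)"
  using assms prime_CHAR freshmans_dream_sum'[where 'a = 'l] unfolding char_power_def CHAR_eq by blast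

lemma inj_power:
  assumes r: "char_power r"
  shows "inj (\<lambda>y :: 'l. y ^ r)"
proof (rule injI)
  fix y z :: 'l assume eq: "y ^ r = z ^ r"
  have "(y - z + z) ^ r = (y - z) ^ r + z ^ r"
    using r prime_CHAR freshmans_dream'[where 'a = 'l] unfolding char_power_def CHAR_eq by blast
  with eq have "(y - z) ^ r = 0" by simp
  then show "y = z" by simp
qed

lemma power_card_power: "a ^ (CARD('a) ^ k) = (a :: 'a)"
  by (induction k) (simp_all add: power_mult power_card_finite_field)

lemma card_field_gt_1: "CARD('a) > 1"
proof -
  have "card {0, 1 :: 'a} \<le> CARD('a)" by (rule card_mono) auto
  then show ?thesis by simp
qed

definition combination :: "'l ^ 'n \<Rightarrow> 'a ^ 'n::finite \<Rightarrow> 'l" where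
  "combination y u = (\<Sum>j\<in>UNIV. emb (u $ j) * y $ j)"

lemma combination_power:
  assumes r: "char_power r"
  shows "combination y u ^ (r * CARD('a) ^ k) = (\<Sum>j\<in>UNIV. emb ((u $ j) ^ r) * (y $ j) ^ (r * CARD('a) ^ k))"
  unfolding combination_def power_sum[OF char_power_mult_card_power[OF r]] power_mult_distrib
  by (simp only: power_mult emb_power[symmetric] power_card_power)

text \<open>
  A polynomial whose exponents are powers of the order \<open>q\<close> of the ground field is linear over that
  field. If it vanishes at the coordinates of \<open>y\<close> it vanishes on their span, and a nonzero polynomial
  of degree less than \<open>q ^ m\<close> has too few roots for that. The common exponent \<open>r\<close> is absorbed by passing from
  \<open>y\<close> to the vector of \<open>r\<close>-th powers, which changes the span by a bijection.
\<close>

lemma linearized_vanishing_imp_zero: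
  fixes y :: "'l ^ 'n::finite"
  assumes r: "char_power r" and card: "CARD('a) ^ m \<le> card (range (combination y))"
    and rel: "\<And>j. (\<Sum>k<m. c k * (y $ j) ^ (r * CARD('a) ^ k)) = 0" and k: "k < m"
  shows "c k = 0"
proof -
  define p where "p = (\<Sum>k<m. Polynomial.monom (c k) (CARD('a) ^ k))"
  define W where "W = (\<lambda>v. v ^ r) ` range (combination y)"
  have "poly p w = 0" if wW: "w \<in> W" for w
  proof -
    obtain u where w: "w = combination y u ^ r" using wW by (auto simp: W_def)
    have "poly p w = (\<Sum>k<m. c k * combination y u ^ (r * CARD('a) ^ k))"
      by (simp add: p_def poly_sum poly_monom w power_mult)
    also have "\<dots> = (\<Sum>k<m. \<Sum>j\<in>UNIV. emb ((u $ j) ^ r) * (c k * (y $ j) ^ (r * CARD('a) ^ k)))"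
      by (simp only: combination_power[OF r] sum_distrib_left mult_ac)
    also have "\<dots> = (\<Sum>j\<in>UNIV. \<Sum>k<m. emb ((u $ j) ^ r) * (c k * (y $ j) ^ (r * CARD('a) ^ k)))"
      by (rule sum.swap)
    also have "\<dots> = 0"
      by (simp only: sum_distrib_left[symmetric] rel mult_zero_right sum.neutral_const)
    finally show ?thesis .
  qed
  moreover have "card W = card (range (combination y))"
    unfolding W_def by (rule card_image) (use inj_power[OF r] in \<open>auto intro: inj_on_subset\<close>)
  moreover have "Polynomial.degree p < CARD('a) ^ m"
  proof -
    have "Polynomial.degree p \<le> CARD('a) ^ (m - 1)"
      unfolding p_def
    proof (rule degree_sum_le)
      fix i assume "i \<in> {..<m}"
      then have "CARD('a) ^ i \<le> CARD('a) ^ (m - 1)" using card_field_gt_1 by (intro power_increasing) auto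
      then show "Polynomial.degree (Polynomial.monom (c i) (CARD('a) ^ i)) \<le> CARD('a) ^ (m - 1)"
        using degree_monom_le order_trans by blast
    qed simp
    also have "\<dots> < CARD('a) ^ m" using card_field_gt_1 k by (intro power_strict_increasing) auto
    finally show ?thesis .
  qed
  moreover have "0 < CARD('a) ^ m" using card_field_gt_1 by simp
  ultimately have "p = 0"
    using card by (intro poly_eqI_degree[of W]) auto
  moreover have "poly.coeff p (CARD('a) ^ k) = c k"
  proof -
    have "poly.coeff p (CARD('a) ^ k) = (\<Sum>i<m. if i = k then c i else 0)"
      unfolding p_def coeff_sum coeff_monom using card_field_gt_1 by (intro sum.cong) auto
    then show ?thesis using k by simp
  qed
  ultimately show ?thesis by simp
qed

lemma card_range_combination:
  fixes y :: "'l ^ 'n::finite"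
  assumes "inj (combination y)"
  shows "card (range (combination y)) = CARD('a) ^ CARD('n)"
  using card_image[OF assms] by (simp add: CARD_vec)

lemma combination_axis: "combination y (axis j 1) = y $ j"
proof -
  have "combination y (axis j 1) = (\<Sum>i\<in>UNIV. if i = j then y $ i else 0)"
    unfolding combination_def by (rule sum.cong) (auto simp: axis_def)
  then show ?thesis by simp
qed

text \<open>
  The Moore matrix of the vector of \<open>r\<close>-th powers of \<open>y\<close>.
\<close>

definition frob_matrix :: "nat \<Rightarrow> 'l ^ 'n \<Rightarrow> 'l ^ 'n ^ 'n::finite" where
  "frob_matrix r y = (\<chi> j k. (y $ j) ^ (r * CARD('a) ^ index k))"

lemma det_frob_matrix_nonzero:
  fixes y :: "'l ^ 'n::finite"
  assumes y: "inj (combination y)" and r: "char_power r"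
  shows "det (frob_matrix r y) \<noteq> 0"
proof
  assume "det (frob_matrix r y) = 0"
  then obtain c where c: "frob_matrix r y *v c = 0" "c \<noteq> 0"
    by (rule det_eq_0_kernel)
  define c' where "c' i = c $ (inv_into UNIV index i)" for i
  have c': "c' (index k) = c $ k" for k
    unfolding c'_def using bij_index[where 'n = 'n] by (simp add: bij_betw_def)
  have "(\<Sum>k<CARD('n). c' k * (y $ j) ^ (r * CARD('a) ^ k)) = (frob_matrix r y *v c) $ j" for j
    unfolding sum_index[symmetric] c'
    by (simp add: frob_matrix_def matrix_vector_mult_def mult.commute)
  then have "c' k = 0" if "k < CARD('n)" for k
    using linearized_vanishing_imp_zero[OF r _ _ that, of y c'] card_range_combination[OF y] c(1)
    by simp
  then have "c $ k = 0" for k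
    using c' index_less[of k] by metis
  then show False using c(2) by (simp add: vec_eq_iff)
qed

text \<open>
  Both sides are monic of degree \<open>q ^ N\<close> and vanish on the span of the coordinates of \<open>y\<close>, a set of
  \<open>q ^ N\<close> elements.
\<close>

lemma linearized_poly_factorization:
  fixes y :: "'l ^ 'n::finite"
  assumes y: "inj (combination y)"
    and rel: "\<And>j. (y $ j) ^ (CARD('a) ^ CARD('n)) = (\<Sum>k<CARD('n). c k * (y $ j) ^ (CARD('a) ^ k))"
  shows "(\<Prod>v\<in>range (combination y). [:- v, 1:]) =
    Polynomial.monom 1 (CARD('a) ^ CARD('n)) - (\<Sum>k<CARD('n). Polynomial.monom (c k) (CARD('a) ^ k))"
    (is "?l = ?r - ?s")
proof (rule poly_eqI_degree_lead_coeff)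
  let ?V = "range (combination y)" and ?n = "CARD('a) ^ CARD('n)"
  have deg_l: "Polynomial.degree ?l = ?n"
    using card_range_combination[OF y] by (subst degree_prod_sum_eq) auto
  have "poly.coeff ?l (Polynomial.degree ?l) = 1" by (simp add: lead_coeff_prod)
  with deg_l have l: "poly.coeff ?l ?n = 1" by simp
  have "CARD('a) ^ k < ?n" if "k < CARD('n)" for k
    using that card_field_gt_1 by (rule power_strict_increasing)
  then have less: "CARD('a) ^ k \<le> ?n" "CARD('a) ^ k \<noteq> ?n" if "k < CARD('n)" for k
    using that by fastforce+
  show "Polynomial.degree ?l \<le> ?n" using deg_l by simp
  show "Polynomial.degree (?r - ?s) \<le> ?n"
    by (intro degree_diff_le degree_monom_le degree_sum_le finite_lessThan
        order_trans[OF degree_monom_le]) (use less in auto)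
  have "poly.coeff ?s ?n = 0"
    unfolding coeff_sum coeff_monom using less by (intro sum.neutral) auto
  then show "poly.coeff ?l ?n = poly.coeff (?r - ?s) ?n" using l by simp
  show "?n \<le> card ?V" using card_range_combination[OF y] by simp
  fix v assume v: "v \<in> ?V"
  then obtain u where u: "v = combination y u" by blast
  have pow: "v ^ (CARD('a) ^ k) = (\<Sum>j\<in>UNIV. emb (u $ j) * (y $ j) ^ (CARD('a) ^ k))" for k
    using combination_power[OF char_power_1, of y u k] u by simp
  have "poly ?s v = (\<Sum>k<CARD('n). \<Sum>j\<in>UNIV. emb (u $ j) * (c k * (y $ j) ^ (CARD('a) ^ k)))"
    by (simp add: poly_sum poly_monom pow sum_distrib_left mult_ac)
  also have "\<dots> = (\<Sum>j\<in>UNIV. \<Sum>k<CARD('n). emb (u $ j) * (c k * (y $ j) ^ (CARD('a) ^ k)))"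
    by (rule sum.swap)
  also have "\<dots> = v ^ ?n"
    by (simp only: sum_distrib_left[symmetric] rel[symmetric] pow)
  finally have "poly (?r - ?s) v = 0" by (simp add: poly_monom)
  moreover have "poly ?l v = 0"
    unfolding poly_prod using v by (intro prod_zero) auto
  ultimately show "poly ?l v = poly (?r - ?s) v" by simp
qed

end

section \<open>Forms and their Frobenius twists\<close>

context finite_field_embedding
begin

definition form :: "'a ^ 'n ^ 'n \<Rightarrow> 'l ^ 'n \<Rightarrow> 'l ^ 'n::finite \<Rightarrow> 'l" where
  "form M u v = scalar_product (u v* map_matrix emb M) v"

lemma form_sum: "form M u v = (\<Sum>i\<in>UNIV. \<Sum>j\<in>UNIV. u $ i * emb (M $ i $ j) * v $ j)"
proof -
  have "form M u v = (\<Sum>j\<in>UNIV. \<Sum>i\<in>UNIV. u $ i * emb (M $ i $ j) * v $ j)"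
    by (simp add: form_def scalar_product_def vector_matrix_mult_def sum_distrib_left mult_ac)
  also have "\<dots> = (\<Sum>i\<in>UNIV. \<Sum>j\<in>UNIV. u $ i * emb (M $ i $ j) * v $ j)"
    by (rule sum.swap)
  finally show ?thesis .
qed

lemma form_transpose: "form (transpose M) u v = form M v u"
proof -
  have "form (transpose M) u v = (\<Sum>i\<in>UNIV. \<Sum>j\<in>UNIV. v $ j * emb (M $ j $ i) * u $ i)"
    by (simp add: form_sum transpose_def mult_ac)
  also have "\<dots> = form M v u"
    unfolding form_sum by (rule sum.swap)
  finally show ?thesis .
qed

lemma form_uminus: "form (- M) u v = - form M u v"
  by (simp add: form_sum emb_uminus sum_negf)

lemma form_diff: "form (M - M') u v = form M u v - form M' u v"
  by (simp add: form_sum emb_diff algebra_simps sum_subtractf)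

lemma form_power:
  assumes "char_power r"
  shows "form M u v ^ r = form (map_matrix (\<lambda>a. a ^ r) M) (vpow u r) (vpow v r)"
  by (simp add: form_sum power_sum[OF assms] power_mult_distrib emb_power)

lemma form_power_card:
  "form M u v ^ (CARD('a) ^ k) = form M (vpow u (CARD('a) ^ k)) (vpow v (CARD('a) ^ k))"
proof -
  have "map_matrix (\<lambda>a. a ^ (CARD('a) ^ k)) M = M"
    by (simp add: vec_eq_iff power_card_power)
  then show ?thesis
    using form_power[OF char_power_power[OF char_power_card], of M u v k] by simp
qed

lemma map_matrix_emb_mult: "map_matrix emb (A ** B) = map_matrix emb A ** map_matrix emb B"
  by (simp add: vec_eq_iff matrix_matrix_mult_def emb_sum emb_mult)

lemma form_left_mult: "form M (u v* map_matrix emb T) v = form (T ** M) u v"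
  by (simp add: form_def map_matrix_emb_mult vector_matrix_mul_assoc)

lemma form_right_mult: "form M u (v v* map_matrix emb T) = form (M ** transpose T) u v"
proof -
  have "form M u (v v* map_matrix emb T) = form (T ** transpose M) v u"
    by (simp only: form_transpose[symmetric, of M] form_left_mult)
  also have "\<dots> = form (transpose (M ** transpose T)) v u"
    by (simp add: matrix_transpose_mul)
  finally show ?thesis by (simp only: form_transpose)
qed

lemma vpow_mult:
  assumes "char_power r"
  shows "vpow (y v* map_matrix emb T) (r * CARD('a) ^ k) =
    vpow y (r * CARD('a) ^ k) v* map_matrix emb (map_matrix (\<lambda>a. a ^ r) T)"
proof -
  have "emb a ^ (r * CARD('a) ^ k) = emb (a ^ r)" for a
    by (simp only: power_mult emb_power[symmetric] power_card_power)
  then show ?thesis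
    by (simp add: vec_eq_iff vector_matrix_mult_def power_sum[OF char_power_mult_card_power[OF assms]]
        power_mult_distrib)
qed

text \<open>
  The matrix entries of \<open>T\<close> are fixed by \<open>q\<close>-th powers, so the twist by \<open>r * q ^ k\<close> sees only the
  exponent \<open>r\<close>, and one change of matrix serves all \<open>k\<close>.
\<close>

lemma form_linear_change:
  fixes M T :: "'a ^ 'n ^ 'n::finite"
  assumes "char_power r"
  shows "form M (u v* map_matrix emb T) (vpow (v v* map_matrix emb T) (r * CARD('a) ^ k)) =
    form (T ** M ** transpose (map_matrix (\<lambda>a. a ^ r) T)) u (vpow v (r * CARD('a) ^ k))"
  by (simp only: vpow_mult[OF assms] form_left_mult form_right_mult matrix_mul_assoc)

lemma mult_combination: "(y v* map_matrix emb T) $ j = combination y (column j T)"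
  by (simp add: vector_matrix_mult_def combination_def column_def mult.commute)

lemma combination_eq_0_iff:
  assumes "inj (combination y)"
  shows "combination y u = 0 \<longleftrightarrow> u = 0"
proof -
  have "combination y 0 = 0" by (simp add: combination_def)
  then show ?thesis using assms by (metis injD)
qed

lemma transpose_mult_form:
  "(transpose (map_matrix emb M ** P) *v w) $ k = form M w (column k P)"
proof -
  have "(transpose (map_matrix emb M ** P) *v w) $ k = ((w v* map_matrix emb M) v* P) $ k"
    by (simp only: transpose_matrix_vector vector_matrix_mul_assoc)
  also have "\<dots> = scalar_product (w v* map_matrix emb M) (column k P)"
    by (simp add: vector_matrix_mult_def[of _ P] scalar_product_def column_def)
  finally show ?thesis by (simp only: form_def)
qed

lemma gram_matrix_nth:
  "(transpose P ** map_matrix emb M ** R) $ i $ k = form M (column i P) (column k R)"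
proof -
  have "(transpose P ** map_matrix emb M ** R) $ i $ k =
      (\<Sum>b\<in>UNIV. \<Sum>a\<in>UNIV. P $ a $ i * emb (M $ a $ b) * R $ b $ k)"
    by (simp add: matrix_matrix_mult_def transpose_def sum_distrib_right)
  also have "\<dots> = (\<Sum>a\<in>UNIV. \<Sum>b\<in>UNIV. P $ a $ i * emb (M $ a $ b) * R $ b $ k)"
    by (rule sum.swap)
  finally show ?thesis by (simp add: form_sum column_def)
qed

lemma column_frob_matrix: "column k (frob_matrix r y) = vpow y (r * CARD('a) ^ index k)"
  by (simp add: vec_eq_iff column_def frob_matrix_def)

lemma det_map_matrix_emb: "det (map_matrix emb M) = emb (det M)"
  by (rule det_map_matrix_hom) (simp_all add: emb_add emb_mult)

text \<open>
  The twists \<open>y ^ (q ^ k)\<close> with \<open>k < N\<close> form a basis, in which \<open>y ^ (q ^ N)\<close> has coordinates \<open>c\<close>.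
  Pairing this expansion with the twists \<open>y ^ (r * q ^ j)\<close> gives a linear system for \<open>c\<close> whose matrix
  and right-hand side consist of values of the form; the matrix is a product of two Moore matrices
  and \<open>M\<close>, hence nonsingular.
\<close>

lemma linear_relation_in_subfield:
  fixes y :: "'l ^ 'n::finite"
  assumes E: "is_subfield E" and y: "inj (combination y)" and r: "char_power r"
    and M: "det M \<noteq> 0"
    and gram: "\<And>i j. i \<le> CARD('n) \<Longrightarrow> j < CARD('n) \<Longrightarrow>
      form M (vpow y (CARD('a) ^ i)) (vpow y (r * CARD('a) ^ j)) \<in> E"
  shows "\<exists>c. (\<forall>k. c k \<in> E) \<and>
    (\<forall>j. (y $ j) ^ (CARD('a) ^ CARD('n)) = (\<Sum>k<CARD('n). c k * (y $ j) ^ (CARD('a) ^ k)))"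
proof -
  define P where "P = frob_matrix 1 y"
  define R where "R = frob_matrix r y"
  define w where "w = vpow y (CARD('a) ^ CARD('n))"
  have P: "det P \<noteq> 0" and R: "det R \<noteq> 0"
    unfolding P_def R_def by (intro det_frob_matrix_nonzero y char_power_1 r)+
  have "\<exists>z. P *v z = w" using cramer[OF P] by blast
  then obtain z where z: "P *v z = w" by blast
  let ?A = "transpose (map_matrix emb M ** R) ** P"
  have A: "?A = transpose (transpose P ** map_matrix emb M ** R)"
    by (simp add: matrix_transpose_mul matrix_mul_assoc)
  have "z $ k \<in> E" for k
  proof (rule linear_system_solution_in_subfield[OF E])
    show "?A $ i $ j \<in> E" for i j
      unfolding A using gram[of "index j" "index i"] index_less[of i] index_less[of j]
      by (simp only: transpose_nth gram_matrix_nth P_def R_def column_frob_matrix mult_1)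
    show "det ?A \<noteq> 0" using P R M by (simp add: det_mul det_map_matrix_emb)
    show "(?A *v z) $ i \<in> E" for i
      using gram[of "CARD('n)" "index i"] index_less[of i]
      by (simp only: matrix_vector_mul_assoc[symmetric] z transpose_mult_form)
        (simp add: R_def w_def column_frob_matrix)
  qed
  moreover define c where "c i = z $ (inv_into UNIV index i)" for i
  ultimately have "c k \<in> E" for k by simp
  moreover have "(y $ j) ^ (CARD('a) ^ CARD('n)) = (\<Sum>k<CARD('n). c k * (y $ j) ^ (CARD('a) ^ k))" for j
  proof -
    have c: "c (index k) = z $ k" for k
      unfolding c_def using bij_index[where 'n = 'n] by (simp add: bij_betw_def)
    have "(y $ j) ^ (CARD('a) ^ CARD('n)) = (P *v z) $ j" by (simp add: z w_def)
    also have "\<dots> = (\<Sum>k<CARD('n). c k * (y $ j) ^ (CARD('a) ^ k))"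
      unfolding sum_index[symmetric] c
      by (simp add: P_def frob_matrix_def matrix_vector_mult_def mult.commute)
    finally show ?thesis .
  qed
  ultimately show ?thesis by blast
qed

text \<open>
  A vector is determined by its pairings with a basis of twists of \<open>y\<close>. This recovers all copies of
  the representation from one of them.
\<close>

lemma coordinates_in_subfield:
  fixes y w :: "'l ^ 'n::finite"
  assumes D: "is_subfield D" "range emb \<subseteq> D" "\<And>j. y $ j \<in> D"
    and y: "inj (combination y)" and r: "char_power r" and M: "det M \<noteq> 0"
    and form: "\<And>k. k < CARD('n) \<Longrightarrow> form M w (vpow y (r * CARD('a) ^ k)) \<in> D"
  shows "w $ j \<in> D"
proof (rule linear_system_solution_in_subfield[OF D(1)])
  let ?A = "transpose (map_matrix emb M ** frob_matrix r y)"
  show "?A $ i $ k \<in> D" for i k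
    unfolding transpose_def matrix_matrix_mult_def
    using D(2,3) by (auto simp: frob_matrix_def intro!: subfield_sum[OF D(1)] subfield_mult[OF D(1)]
        subfield_power[OF D(1)])
  show "det ?A \<noteq> 0"
    using det_frob_matrix_nonzero[OF y r] M by (simp add: det_mul det_map_matrix_emb)
  show "(?A *v w) $ k \<in> D" for k
    unfolding transpose_mult_form column_frob_matrix by (rule form) (rule index_less)
qed

text \<open>
  The difference \<open>B\<close> of the two matrices pairs \<open>y\<close> to zero with a basis, so the row vector \<open>y B\<close>
  vanishes; its coordinates are linear combinations over the ground field of the independent
  coordinates of \<open>y\<close>.
\<close>

lemma form_preserving_imp_isometry:
  fixes y :: "'l ^ 'n::finite"
  assumes y: "inj (combination y)" and r: "char_power r"
    and eq: "\<And>k. k < CARD('n) \<Longrightarrow> form M (y v* map_matrix emb T)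
        (vpow (y v* map_matrix emb T) (r * CARD('a) ^ (s + k))) =
      form M y (vpow y (r * CARD('a) ^ (s + k)))"
  shows "T ** M ** transpose (map_matrix (\<lambda>a. a ^ r) T) = M"
proof -
  define B where "B = T ** M ** transpose (map_matrix (\<lambda>a. a ^ r) T) - M"
  let ?R = "frob_matrix (r * CARD('a) ^ s) y"
  have R: "det ?R \<noteq> 0"
    by (rule det_frob_matrix_nonzero[OF y char_power_mult_card_power[OF r]])
  have "form B y (vpow y (r * CARD('a) ^ (s + k))) = 0" if "k < CARD('n)" for k
    using eq[OF that] by (simp add: B_def form_diff form_linear_change[OF r])
  then have "form B y (column k ?R) = 0" for k
    using index_less[of k] by (simp add: column_frob_matrix power_add mult.assoc)
  then have "transpose (map_matrix emb B ** ?R) *v y = 0"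
    by (simp only: vec_eq_iff transpose_mult_form zero_index simp_thms)
  then have "(y v* map_matrix emb B) v* ?R = 0"
    by (simp add: vector_matrix_mul_assoc)
  then have "transpose ?R *v (y v* map_matrix emb B) = 0"
    by simp
  moreover have "det (transpose ?R) \<noteq> 0" using R by simp
  ultimately have "y v* map_matrix emb B = 0"
    using invertible_det_nz[of "transpose ?R"] invertible_left_inverse[of "transpose ?R"]
      matrix_left_invertible_ker[of "transpose ?R"] by blast
  then have "column j B = 0" for j
    using mult_combination[of y B j] combination_eq_0_iff[OF y] by simp
  then have "B = 0" by (simp add: vec_eq_iff column_def)
  then show ?thesis by (simp add: B_def)
qed

end

section \<open>The field of rational functions\<close>

lemma field_endomorphism_simps:
  assumes "field_endomorphism \<sigma>"
  shows "\<sigma> 0 = 0" "\<sigma> 1 = 1" "\<sigma> (a + b) = \<sigma> a + \<sigma> b" "\<sigma> (a * b) = \<sigma> a * \<sigma> b"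
    "\<sigma> (a - b) = \<sigma> a - \<sigma> b" "\<sigma> (inverse a) = inverse (\<sigma> a)" "\<sigma> (a ^ k) = \<sigma> a ^ k"
    "\<sigma> (sum f I) = (\<Sum>i\<in>I. \<sigma> (f i))"
proof -
  show one: "\<sigma> 1 = 1" and add: "\<sigma> (a + b) = \<sigma> a + \<sigma> b" and mult: "\<sigma> (a * b) = \<sigma> a * \<sigma> b" for a b
    using assms by (auto simp: field_endomorphism_def)
  show zero: "\<sigma> 0 = 0" using add[of 0 0] by (metis add_0_left add_cancel_right_left)
  show "\<sigma> (a - b) = \<sigma> a - \<sigma> b" using add[of "a - b" b] by simp
  show "\<sigma> (a ^ k) = \<sigma> a ^ k" by (induction k) (simp_all add: one mult)
  show "\<sigma> (sum f I) = (\<Sum>i\<in>I. \<sigma> (f i))"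
    by (induction I rule: infinite_finite_induct) (simp_all add: zero add)
  show "\<sigma> (inverse a) = inverse (\<sigma> a)"
  proof (cases "a = 0")
    case False
    then have "\<sigma> a * \<sigma> (inverse a) = 1" by (simp flip: mult add: one)
    then show ?thesis by (metis inverse_unique)
  qed (simp add: zero)
qed

lemma is_subfield_agreement:
  assumes "field_endomorphism \<sigma>" "field_endomorphism \<tau>"
  shows "is_subfield {a. \<sigma> a = \<tau> a}"
  by (auto simp: is_subfield_def field_endomorphism_simps[OF assms(1)]
      field_endomorphism_simps[OF assms(2)])

lemma field_endomorphism_id: "field_endomorphism (\<lambda>a. a)"
  by (simp add: field_endomorphism_def)

lemma ring_of_type_algebra_simps:
  "\<one>\<^bsub>ring_of_type_algebra\<^esub> = (1 :: 'l::field)" "\<zero>\<^bsub>ring_of_type_algebra\<^esub> = (0 :: 'l)"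
  "a \<oplus>\<^bsub>ring_of_type_algebra\<^esub> b = a + (b :: 'l)" "a \<otimes>\<^bsub>ring_of_type_algebra\<^esub> b = a * (b :: 'l)"
  "carrier ring_of_type_algebra = (UNIV :: 'l set)"
  by (simp_all add: ring_of_type_algebra_def)

lemma ring_of_type_algebra_inverse:
  fixes a :: "'l::field"
  shows "\<ominus>\<^bsub>ring_of_type_algebra\<^esub> a = - a"
    and "a \<noteq> 0 \<Longrightarrow> inv\<^bsub>ring_of_type_algebra\<^esub> a = inverse a"
proof -
  interpret R: field "ring_of_type_algebra :: 'l ring" by (rule field_from_type_algebra)
  show "\<ominus>\<^bsub>ring_of_type_algebra\<^esub> a = - a"
    by (rule R.minus_equality) (simp_all add: ring_of_type_algebra_simps)
  show "inv\<^bsub>ring_of_type_algebra\<^esub> a = inverse a" if "a \<noteq> 0"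
    by (rule R.comm_inv_char) (use that in \<open>simp_all add: ring_of_type_algebra_simps\<close>)
qed

lemma is_subfield_adjoin:
  fixes S :: "('a::field, 'm, 'n) ratfun set"
  shows "is_subfield (adjoin S)"
proof -
  note gen = generate_field.intros[where R = ring_of_type_algebra and H = "range rconst \<union> S"]
  have add: "a + b \<in> adjoin S" if "a \<in> adjoin S" "b \<in> adjoin S" for a b
    using gen(5)[of a b] that by (simp add: adjoin_def ring_of_type_algebra_simps)
  have uminus: "- a \<in> adjoin S" if "a \<in> adjoin S" for a
    using gen(3)[of a] that by (simp add: adjoin_def ring_of_type_algebra_inverse)
  have one: "1 \<in> adjoin S"
    using gen(1) by (simp add: adjoin_def ring_of_type_algebra_simps)
  have zero: "0 \<in> adjoin S" using add[OF one uminus[OF one]] by simp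
  show ?thesis unfolding is_subfield_def
  proof (intro conjI ballI one)
    fix a assume a: "a \<in> adjoin S"
    show "inverse a \<in> adjoin S"
      using gen(4)[of a] a zero
      by (cases "a = 0") (simp_all add: adjoin_def ring_of_type_algebra_inverse ring_of_type_algebra_simps)
    fix b assume b: "b \<in> adjoin S"
    show "a - b \<in> adjoin S" using add[OF a uminus[OF b]] by simp
    show "a * b \<in> adjoin S"
      using gen(6)[of a b] a b by (simp add: adjoin_def ring_of_type_algebra_simps)
  qed
qed

lemma subset_adjoin: "range rconst \<subseteq> adjoin S" "S \<subseteq> adjoin S"
  unfolding adjoin_def by (auto intro: generate_field.incl)

lemma adjoin_least:
  assumes D: "is_subfield D" and "range rconst \<subseteq> D" "S \<subseteq> D"
  shows "adjoin S \<subseteq> D"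
proof
  fix a assume "a \<in> adjoin S"
  then show "a \<in> D" unfolding adjoin_def
  proof (induction rule: generate_field.induct)
    case (m_inv h)
    then show ?case
      using subfield_inverse[OF D] by (simp add: ring_of_type_algebra_inverse ring_of_type_algebra_simps)
  qed (use assms subfield_1[OF D] subfield_uminus[OF D] subfield_add[OF D] subfield_mult[OF D]
      in \<open>auto simp: ring_of_type_algebra_inverse ring_of_type_algebra_simps\<close>)
qed

lemma Fract_hom:
  fixes p q :: "'r::idom"
  shows "Fraction_Field.Fract (p + q) 1 = Fraction_Field.Fract p 1 + Fraction_Field.Fract q 1"
    "Fraction_Field.Fract (p * q) 1 = Fraction_Field.Fract p 1 * Fraction_Field.Fract q 1"
    "Fraction_Field.Fract (p ^ k) 1 = Fraction_Field.Fract p 1 ^ k"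
    "Fraction_Field.Fract (prod f I) 1 = (\<Prod>i\<in>I. Fraction_Field.Fract (f i) (1 :: 'r))"
    "Fraction_Field.Fract (sum f I) 1 = (\<Sum>i\<in>I. Fraction_Field.Fract (f i) (1 :: 'r))"
proof -
  show add: "Fraction_Field.Fract (p + q) 1 = Fraction_Field.Fract p 1 + Fraction_Field.Fract q 1"
    and mult: "Fraction_Field.Fract (p * q) 1 = Fraction_Field.Fract p 1 * Fraction_Field.Fract q 1"
    for p q :: 'r
    by simp_all
  show "Fraction_Field.Fract (p ^ k) 1 = Fraction_Field.Fract p 1 ^ k"
    by (induction k) (simp_all only: power_Suc power_0 mult One_fract_def)
  show "Fraction_Field.Fract (prod f I) 1 = (\<Prod>i\<in>I. Fraction_Field.Fract (f i) (1 :: 'r))"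
    by (induction I rule: infinite_finite_induct)
      (simp_all only: prod.insert prod.empty prod.infinite mult One_fract_def not_False_eq_True)
  show "Fraction_Field.Fract (sum f I) 1 = (\<Sum>i\<in>I. Fraction_Field.Fract (f i) (1 :: 'r))"
    by (induction I rule: infinite_finite_induct)
      (simp_all only: sum.insert sum.empty sum.infinite add Zero_fract_def not_False_eq_True)
qed

lemma subfield_containing_coordinates_eq_UNIV:
  fixes D :: "('a::field, 'm, 'n::finite) ratfun set"
  assumes D: "is_subfield D" and const: "range rconst \<subseteq> D" and var: "\<And>i j. coord_vec i $ j \<in> D"
  shows "D = UNIV"
proof -
  have poly: "Fraction_Field.Fract p 1 \<in> D" for p :: "('a, 'm, 'n) mpol"
  proof -
    have v: "Fraction_Field.Fract (pvar v) 1 \<in> D" for v :: "('m, 'n) coord"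
      using var by (cases v) (simp add: coord_vec_def)
    have c: "Fraction_Field.Fract (pconst a) 1 \<in> D" for a :: 'a
      using const unfolding rconst_def by blast
    have "Fraction_Field.Fract (psubst pvar p) 1 \<in> D"
      unfolding psubst_def Fract_hom
      by (intro subfield_sum[OF D] subfield_mult[OF D] subfield_prod[OF D] subfield_power[OF D] c v)
    then show ?thesis by (simp only: psubst_id)
  qed
  have "f \<in> D" for f
  proof (cases f)
    case (Fract a b)
    then have "f = Fraction_Field.Fract a 1 / Fraction_Field.Fract b 1" by simp
    then show ?thesis using subfield_divide[OF D poly poly] by simp
  qed
  then show ?thesis by blast
qed

interpretation rconst: finite_field_embedding "rconst :: 'a::{field,finite} \<Rightarrow> ('a, 'm, 'n) ratfun"
proof
  show "rconst 1 = (1 :: ('a, 'm, 'n) ratfun)"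
    by (simp add: rconst_def pconst_def One_fract_def)
  show "rconst (a + b) = (rconst a + rconst b :: ('a, 'm, 'n) ratfun)" for a b
    by (simp add: rconst_def pconst_def single_add)
  show "rconst (a * b) = (rconst a * rconst b :: ('a, 'm, 'n) ratfun)" for a b
    by (simp add: rconst_def pconst_mult)
qed

lemma inj_combination_coord_vec:
  "inj (rconst.combination (coord_vec i :: ('a::{field,finite}, 'm, 'n::finite) ratfun ^ 'n))"
proof (rule injI)
  fix u u' :: "'a ^ 'n"
  assume eq: "rconst.combination (coord_vec i :: ('a, 'm, 'n) ratfun ^ 'n) u =
    rconst.combination (coord_vec i) u'"
  have comb: "rconst.combination (coord_vec i :: ('a, 'm, 'n) ratfun ^ 'n) u =
      Fraction_Field.Fract (\<Sum>j\<in>UNIV. pconst (u $ j) * pvar (Coord i j)) 1" for u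
    unfolding rconst.combination_def Fract_hom by (simp add: rconst_def coord_vec_def)
  have *: "(\<Sum>j\<in>UNIV. pconst (u $ j) * pvar (Coord i j)) =
      (\<Sum>j\<in>UNIV. pconst (u' $ j) * pvar (Coord i j) :: ('a, 'm, 'n) mpol)"
    using eq unfolding comb by (simp add: eq_fract)
  have "u $ k = u' $ k" for k
  proof -
    let ?s = "\<lambda>v. if v = Coord i k then 1 else 0 :: ('a, 'm, 'n) mpol"
    have "psubst ?s (\<Sum>j\<in>UNIV. pconst (u $ j) * pvar (Coord i j)) = pconst (u $ k)" for u :: "'a ^ 'n"
      by (simp add: psubst_sum psubst_mult if_distrib cong: if_cong)
    from this[of u] this[of u'] have "pconst (u $ k) = (pconst (u' $ k) :: ('a, 'm, 'n) mpol)"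
      by (simp only: *)
    then show ?thesis unfolding pconst_def by (metis lookup_single_eq)
  qed
  then show "u = u'" by (simp add: vec_eq_iff)
qed

lemma frob_form_eq_form: "frob_form M i j e = rconst.form M (coord_vec i) (vpow (coord_vec j) e)"
  by (simp add: frob_form_def rconst.form_def vpow_def)

lemma field_endomorphism_act:
  fixes T :: "'a::field ^ 'n ^ 'n::finite"
  assumes "invertible T"
  shows "field_endomorphism (act T :: ('a, 'm, 'n) ratfun \<Rightarrow> _)"
proof -
  have "act T (1 :: ('a, 'm, 'n) ratfun) = 1"
    using act_automorphism(4)[OF assms, of 1] by (simp add: rconst_def pconst_def One_fract_def)
  then show ?thesis
    unfolding field_endomorphism_def
    by (intro conjI allI act_automorphism(2,3)[OF assms])
qed

section \<open>The fixed field of an isometry group\<close>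

text \<open>
  The common core of the three cases: \<open>r = 1\<close> for the symplectic and the orthogonal group, \<open>r = q\<close>
  for the unitary group over the field of order \<open>q\<^sup>2\<close>. Any \<open>N\<close> consecutive twists, starting at \<open>s\<close>,
  serve as generators, provided that the Gram matrix of twists of the reference copy \<open>y\<close> has its
  entries in the generated field.
\<close>

theorem fixed_field_isometry_group:
  fixes M :: "'a::{field,finite} ^ 'n ^ 'n::finite" and i\<^sub>1 :: 'm
  defines "y \<equiv> (coord_vec i\<^sub>1 :: ('a, 'm, 'n) ratfun ^ 'n)"
  assumes r: "rconst.char_power TYPE('a) r" and M: "det M \<noteq> 0"
    and S: "S = {frob_form M i i\<^sub>1 (r * CARD('a) ^ (s + k)) | i k. k < CARD('n)}"
    and gram: "\<And>i j. i \<le> CARD('n) \<Longrightarrow> j < CARD('n) \<Longrightarrow>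
      rconst.form M (vpow y (CARD('a) ^ i)) (vpow y (r * CARD('a) ^ j)) \<in> adjoin S"
  shows "fixed_field {T. invertible T \<and> T ** M ** transpose (conj_matrix r T) = M} = adjoin S"
    (is "fixed_field ?G = _")
proof
  have inj: "inj (rconst.combination y)"
    unfolding y_def by (rule inj_combination_coord_vec)
  have form_image: "\<sigma> (rconst.form M u v) = rconst.form M (\<chi> j. \<sigma> (u $ j)) (\<chi> j. \<sigma> (v $ j))"
    if "field_endomorphism \<sigma>" "\<And>c. \<sigma> (rconst c) = rconst c" for \<sigma> and u v :: "('a, 'm, 'n) ratfun ^ 'n"
    by (simp add: rconst.form_sum field_endomorphism_simps[OF that(1)] that(2))
  have vpow_image: "(\<chi> j. \<sigma> (vpow u e $ j)) = vpow (\<chi> j. \<sigma> (u $ j)) e"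
    if "field_endomorphism \<sigma>" for \<sigma> and u :: "('a, 'm, 'n) ratfun ^ 'n" and e
    by (simp add: vec_eq_iff field_endomorphism_simps[OF that])
  have act_form: "act T f = f" if T: "T \<in> ?G" and f: "f \<in> S" for T f
  proof -
    obtain i k where f: "f = frob_form M i i\<^sub>1 (r * CARD('a) ^ (s + k))" using f S by blast
    have inv: "invertible T" using T by simp
    have "act T f = rconst.form M (coord_vec i v* map_matrix rconst T)
        (vpow (coord_vec i\<^sub>1 v* map_matrix rconst T) (r * CARD('a) ^ (s + k)))"
      unfolding f frob_form_eq_form
      by (simp only: form_image[OF field_endomorphism_act[OF inv] act_automorphism(4)[OF inv]]
          vpow_image[OF field_endomorphism_act[OF inv]] act_coord_vec[OF inv])
    also have "\<dots> = f"
      unfolding rconst.form_linear_change[OF r] f frob_form_eq_form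
      using T by (simp add: conj_matrix_def)
    finally show ?thesis .
  qed
  show sub: "adjoin S \<subseteq> fixed_field ?G"
  proof (rule adjoin_least)
    have "is_subfield {f. act T f = f}" if "T \<in> ?G" for T
      using that by (intro is_subfield_agreement field_endomorphism_act field_endomorphism_id) simp
    then show "is_subfield (fixed_field ?G)"
      unfolding fixed_field_def is_subfield_def by blast
    show "range rconst \<subseteq> fixed_field ?G"
      by (auto simp: fixed_field_def act_automorphism(4))
    show "S \<subseteq> fixed_field ?G"
      using act_form by (auto simp: fixed_field_def)
  qed
  show "fixed_field ?G \<subseteq> adjoin S"
  proof
    fix f :: "('a, 'm, 'n) ratfun"
    assume f: "f \<in> fixed_field ?G"
    let ?E = "adjoin S" and ?V = "range (rconst.combination y)"
    note E = is_subfield_adjoin[of S]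
    have const: "rconst c \<in> ?E" for c using subset_adjoin(1) by blast
    have gen: "D = UNIV" if D: "is_subfield D" "?E \<subseteq> D" "range (($) y) \<subseteq> D" for D
    proof (rule subfield_containing_coordinates_eq_UNIV[OF D(1)])
      show "range rconst \<subseteq> D" using const D(2) by blast
      show "coord_vec i $ j \<in> D" for i j
      proof (rule rconst.coordinates_in_subfield[OF D(1) _ _ inj rconst.char_power_mult_card_power[OF r] M])
        show "range rconst \<subseteq> D" using const D(2) by blast
        show "y $ j \<in> D" for j using D(3) by blast
        show "rconst.form M (coord_vec i) (vpow y (r * CARD('a) ^ s * CARD('a) ^ k)) \<in> D"
          if "k < CARD('n)" for k
        proof -
          have "frob_form M i i\<^sub>1 (r * CARD('a) ^ (s + k)) \<in> S" using S that by blast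
          then show ?thesis
            using subset_adjoin(2) D(2) by (auto simp: frob_form_eq_form y_def power_add mult.assoc)
        qed
      qed
    qed
    obtain c where c: "\<And>k. c k \<in> ?E" and
      rel: "\<And>j. (y $ j) ^ (CARD('a) ^ CARD('n)) = (\<Sum>k<CARD('n). c k * (y $ j) ^ (CARD('a) ^ k))"
      using rconst.linear_relation_in_subfield[OF E inj r M gram] by blast
    show "f \<in> ?E"
    proof (rule fixed_by_endomorphisms_in_subfield[OF E _ gen])
      show "finite (range (($) y))" by simp
      show "finite ?V" by simp
      show "x \<in> ?V" if x: "x \<in> range (($) y)" for x
      proof -
        obtain j where "x = y $ j" using x by blast
        then have "x = rconst.combination y (axis j 1)" by (simp add: rconst.combination_axis)
        then show ?thesis by blast
      qed
      show "poly.coeff (\<Prod>v\<in>?V. [:- v, 1:]) i \<in> ?E" for i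
        unfolding rconst.linearized_poly_factorization[OF inj rel] coeff_diff coeff_sum coeff_monom
        using subfield_0[OF E] subfield_1[OF E] c
        by (intro subfield_diff[OF E] subfield_sum[OF E]) auto
      fix \<sigma> :: "('a, 'm, 'n) ratfun \<Rightarrow> ('a, 'm, 'n) ratfun"
      assume \<sigma>: "field_endomorphism \<sigma>" and fixE: "\<And>c. c \<in> ?E \<Longrightarrow> \<sigma> c = c"
        and range: "\<And>x. x \<in> range (($) y) \<Longrightarrow> \<sigma> x \<in> ?V"
      have "\<forall>j. \<exists>u. \<sigma> (y $ j) = rconst.combination y u" using range by blast
      then obtain t where t: "\<And>j. \<sigma> (y $ j) = rconst.combination y (t j)" by metis
      \<comment> \<open>The roots of the linearized polynomial are the combinations of the coordinates of \<open>y\<close>, so \<open>\<sigma>\<close> acts on \<open>y\<close> by a matrix over the ground field.\<close>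
      define T where "T = (\<chi> i j. t j $ i)"
      have yT: "(\<chi> j. \<sigma> (y $ j)) = y v* map_matrix rconst T"
        by (simp add: vec_eq_iff rconst.mult_combination t T_def column_def)
      have iso: "T ** M ** transpose (map_matrix (\<lambda>a. a ^ r) T) = M"
      proof (rule rconst.form_preserving_imp_isometry[OF inj r, where s = s])
        fix k assume k: "k < CARD('n)"
        let ?e = "r * CARD('a) ^ (s + k)"
        have "frob_form M i\<^sub>1 i\<^sub>1 ?e \<in> S" unfolding S using k by blast
        then have "frob_form M i\<^sub>1 i\<^sub>1 ?e \<in> ?E" using subset_adjoin(2) by blast
        then have "\<sigma> (rconst.form M y (vpow y ?e)) = rconst.form M y (vpow y ?e)"
          using fixE by (simp add: frob_form_eq_form y_def)
        then show "rconst.form M (y v* map_matrix rconst T) (vpow (y v* map_matrix rconst T) ?e) =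
            rconst.form M y (vpow y ?e)"
          by (simp only: form_image[OF \<sigma> fixE[OF const]] vpow_image[OF \<sigma>] yT)
      qed
      have "det T \<noteq> 0"
        using arg_cong[OF iso, of det] M by (auto simp: det_mul)
      then have T: "T \<in> ?G"
        using iso invertible_det_nz by (auto simp: conj_matrix_def)
      then have inv: "invertible T" by simp
      \<comment> \<open>Two endomorphisms that agree on generators are equal.\<close>
      have "{a. \<sigma> a = act T a} = UNIV"
      proof (rule gen)
        show "is_subfield {a. \<sigma> a = act T a}"
          by (intro is_subfield_agreement \<sigma> field_endomorphism_act inv)
        show "?E \<subseteq> {a. \<sigma> a = act T a}"
          using sub fixE T by (auto simp: fixed_field_def)
        have "(\<chi> j. act T (y $ j)) = (\<chi> j. \<sigma> (y $ j))"
          using act_coord_vec[OF inv] yT y_def by simp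
        then show "range (($) y) \<subseteq> {a. \<sigma> a = act T a}"
          by (auto simp: vec_eq_iff)
      qed
      then have "\<sigma> f = act T f" by blast
      also have "\<dots> = f" using f T unfolding fixed_field_def by blast
      finally show "\<sigma> f = f" .
    qed
  qed
qed

section \<open>One more value of a symmetric form\<close>

text \<open>
  For a symmetric form \<open>A\<close> the Gram matrix of the twists requires the value
  \<open>form A y (y ^ (q ^ N))\<close>, which is not among the generators. In the matrix \<open>G\<close> of the pairings of
  \<open>y ^ (q ^ i)\<close> with \<open>y ^ (q ^ (j + 1))\<close>, where \<open>i\<close> and \<open>j\<close> run through \<open>0, \<dots>, N - 1\<close>, it is the entry
  for \<open>i = 0\<close>, \<open>j = N - 1\<close>, and the only one not yet known to lie in the generated field. The determinant of
  \<open>minor_matrix\<close> is the cofactor of that entry: row \<open>0\<close> is replaced by a unit vector.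

  The matrix is defined over any commutative ring so that a substitution of polynomials can be
  applied to it.
\<close>

definition minor_matrix ::
    "('a \<Rightarrow> 'r) \<Rightarrow> nat \<Rightarrow> 'a::field ^ 'n ^ 'n \<Rightarrow> 'r::comm_ring_1 ^ 'n \<Rightarrow> 'r ^ 'n ^ 'n::finite" where
  "minor_matrix h q A y = (\<chi> i j. if index i = 0 then (if Suc (index j) = CARD('n) then 1 else 0)
     else \<Sum>k\<in>UNIV. \<Sum>l\<in>UNIV. y $ k ^ (q ^ index i) * h (A $ k $ l) * y $ l ^ (q * q ^ index j))"

lemma det_minor_matrix_hom:
  fixes f :: "'r::comm_ring_1 \<Rightarrow> 's::comm_ring_1" and A :: "'a::field ^ 'n ^ 'n::finite"
  assumes one: "f 1 = 1" and add: "\<And>a b. f (a + b) = f a + f b"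
    and mult: "\<And>a b. f (a * b) = f a * f b"
  shows "f (det (minor_matrix h q A y)) = det (minor_matrix (\<lambda>c. f (h c)) q A (\<chi> j. f (y $ j)))"
proof -
  have zero: "f 0 = 0" using add[of 0 0] by (metis add_0_left add_cancel_right_left)
  have sum: "f (sum g I) = (\<Sum>i\<in>I. f (g i))" for g and I :: "'n set"
    by (induction I rule: infinite_finite_induct) (simp_all add: zero add)
  have power: "f (a ^ k) = f a ^ k" for a k
    by (induction k) (simp_all add: one mult)
  have "map_matrix f (minor_matrix h q A y) = minor_matrix (\<lambda>c. f (h c)) q A (\<chi> j. f (y $ j))"
    by (simp add: vec_eq_iff minor_matrix_def zero one sum mult power)
  then show ?thesis
    using det_map_matrix_hom[of f, OF one add mult] by metis
qed

context finite_field_embedding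
begin

lemma minor_matrix_nth:
  "minor_matrix emb (CARD('a)) A y $ i $ j =
    (if index i = 0 then (if Suc (index j) = CARD('n) then 1 else 0)
     else form A (vpow y (CARD('a) ^ index i)) (column j (frob_matrix (CARD('a)) y)))"
  for y :: "'l ^ 'n::finite"
  by (simp add: minor_matrix_def form_sum column_frob_matrix)

lemma form_mult_vector: "form M u (R *v c) = (\<Sum>j\<in>UNIV. form M u (column j R) * c $ j)"
proof -
  have "form M u (R *v c) = (\<Sum>i\<in>UNIV. \<Sum>j\<in>UNIV. (u v* map_matrix emb M) $ i * (R $ i $ j * c $ j))"
    by (simp add: form_def scalar_product_def matrix_vector_mult_def sum_distrib_left)
  also have "\<dots> = (\<Sum>j\<in>UNIV. \<Sum>i\<in>UNIV. (u v* map_matrix emb M) $ i * (R $ i $ j * c $ j))"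
    by (rule sum.swap)
  finally show ?thesis
    by (simp add: form_def scalar_product_def column_def sum_distrib_right mult.assoc)
qed

lemma form_eq_row: "form M u v = (\<Sum>i\<in>UNIV. u $ i * (map_matrix emb M *v v) $ i)"
  by (simp add: form_sum matrix_vector_mult_def sum_distrib_left mult.assoc)

text \<open>
  The cofactor is, up to sign, the Gram determinant of \<open>y ^ q, \<dots>, y ^ (q ^ (N - 1))\<close>. If \<open>y\<close> lies in
  the hyperplane orthogonal to an anisotropic vector \<open>u\<close> that is fixed by Frobenius, so do its twists.
  The bound on the span makes them independent, so they span this hyperplane, on which the form is
  nondegenerate.
\<close>

lemma det_minor_matrix_nonzero:
  fixes A :: "'a ^ 'n ^ 'n::finite" and y :: "'l ^ 'n"
  assumes A: "det A \<noteq> 0" and card: "CARD('a) ^ (CARD('n) - 1) \<le> card (range (combination y))"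
    and u: "vpow u (CARD('a)) = u" and orth: "form A u y = 0" and aniso: "form A u u \<noteq> 0"
  shows "det (minor_matrix emb (CARD('a)) A y) \<noteq> 0"
proof
  let ?q = "CARD('a)" and ?n = "CARD('n)"
  obtain i0 i1 :: 'n where i0: "index i0 = 0" and i1: "Suc (index i1) = ?n"
    by (rule index_endpoints)
  have u_pow: "vpow u (?q ^ k) = u" for k
    by (induction k) (simp_all add: power_Suc2 vpow_vpow[symmetric] u del: power_Suc)
  have orth_pow: "form A u (vpow y (?q ^ k)) = 0" for k
    using form_power_card[of A u y k] by (simp add: u_pow orth power_0_left)
  have indep: "c k = 0" if "\<And>j. (\<Sum>k<?n - 1. c k * (y $ j) ^ (?q * ?q ^ k)) = 0" "k < ?n - 1" for c k
    using linearized_vanishing_imp_zero[OF char_power_card card that] .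

  \<comment> \<open>The rows of \<open>B\<close> are \<open>u\<close> and the twists of \<open>y\<close>; they form a basis.\<close>
  define B :: "'l ^ 'n ^ 'n" where "B = (\<chi> i. if index i = 0 then u else vpow y (?q ^ index i))"
  have "det (transpose B) \<noteq> 0"
  proof
    assume "det (transpose B) = 0"
    then obtain d where d: "transpose B *v d = 0" "d \<noteq> 0" by (rule det_eq_0_kernel)
    have "form A u (transpose B *v d) = (\<Sum>j\<in>UNIV. if j = i0 then form A u u * d $ j else 0)"
      unfolding form_mult_vector
    proof (rule sum.cong)
      show "form A u (column j (transpose B)) * d $ j = (if j = i0 then form A u u * d $ j else 0)" for j
        using index_eq_iff[of j i0] i0
        by (simp add: row_def B_def orth_pow)
    qed simp
    moreover have "form A u 0 = 0" by (simp add: form_sum)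
    ultimately have d0: "d $ i0 = 0" using aniso d(1) by simp
    define c where "c k = d $ (inv_into UNIV index (Suc k))" for k
    have "(\<Sum>k<?n - 1. c k * (y $ j) ^ (?q * ?q ^ k)) = 0" for j
    proof -
      define t where "t k = (if k = 0 then 0 else d $ (inv_into UNIV index k) * (y $ j) ^ (?q ^ k))" for k
      have "0 = (transpose B *v d) $ j" using d(1) by simp
      also have "\<dots> = (\<Sum>i\<in>(UNIV :: 'n set). t (index i))"
        unfolding matrix_vector_mult_def vec_lambda_beta transpose_nth
      proof (rule sum.cong)
        show "B $ i $ j * d $ i = t (index i)" for i
          using index_eq_iff[of i i0] i0 d0 by (auto simp: t_def B_def inv_into_index)
      qed simp
      also have "\<dots> = (\<Sum>k<Suc (?n - 1). t k)" by (simp add: sum_index)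
      also have "\<dots> = (\<Sum>k<?n - 1. c k * (y $ j) ^ (?q * ?q ^ k))"
        unfolding sum.lessThan_Suc_shift by (simp add: t_def c_def)
      finally show ?thesis by simp
    qed
    then have c: "c k = 0" if "k < ?n - 1" for k using indep that by blast
    have "d $ i = 0" for i
    proof (cases "index i")
      case 0
      then show ?thesis using index_eq_iff[of i i0] i0 d0 by simp
    next
      case (Suc k)
      then have "k < ?n - 1" using index_less[of i] by simp
      then show ?thesis using c[of k] Suc inv_into_index[of i] by (simp add: c_def)
    qed
    then show False using d(2) by (simp add: vec_eq_iff)
  qed
  then have B: "det B \<noteq> 0" by simp

  assume "det (minor_matrix emb ?q A y) = 0"
  then obtain c where c: "minor_matrix emb ?q A y *v c = 0" "c \<noteq> 0" by (rule det_eq_0_kernel)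
  \<comment> \<open>A kernel vector gives a vector \<open>v\<close> in the hyperplane that is orthogonal to the whole basis \<open>B\<close>.\<close>
  define v where "v = frob_matrix ?q y *v c"
  have "0 = (minor_matrix emb ?q A y *v c) $ i0" using c(1) by simp
  also have "\<dots> = (\<Sum>j\<in>UNIV. if j = i1 then c $ j else 0)"
    unfolding matrix_vector_mult_def vec_lambda_beta
  proof (rule sum.cong)
    show "minor_matrix emb ?q A y $ i0 $ j * c $ j = (if j = i1 then c $ j else 0)" for j
      using index_eq_iff[of j i1] i1 i0 by (auto simp: minor_matrix_nth)
  qed simp
  finally have c1: "c $ i1 = 0" by simp
  have form_v: "form A (vpow y (?q ^ index i)) v = 0" if "index i \<noteq> 0" for i :: 'n
  proof -
    have "form A (vpow y (?q ^ index i)) v = (minor_matrix emb ?q A y *v c) $ i"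
      using that by (simp add: v_def form_mult_vector minor_matrix_nth
          matrix_vector_mult_def[of "minor_matrix emb ?q A y"])
    then show ?thesis using c(1) by simp
  qed
  have "form A u v = 0"
    unfolding v_def form_mult_vector column_frob_matrix power_Suc[symmetric] by (simp add: orth_pow del: power_Suc)
  then have "(B *v (map_matrix emb A *v v)) $ i = 0" for i
  proof -
    have "(B *v (map_matrix emb A *v v)) $ i = form A (B $ i) v"
      unfolding form_eq_row by (simp add: matrix_vector_mult_def[of B])
    then show ?thesis using form_v[of i] \<open>form A u v = 0\<close> by (simp add: B_def)
  qed
  then have "(B ** map_matrix emb A) *v v = 0"
    by (simp add: vec_eq_iff matrix_vector_mul_assoc)
  moreover have "det (B ** map_matrix emb A) \<noteq> 0"
    using A B by (simp add: det_mul det_map_matrix_emb)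
  ultimately have v: "v = 0"
    using invertible_det_nz invertible_left_inverse matrix_left_invertible_ker by blast
  define c' where "c' k = c $ (inv_into UNIV index k)" for k
  have "(\<Sum>k<?n - 1. c' k * (y $ j) ^ (?q * ?q ^ k)) = 0" for j
  proof -
    have "0 = v $ j" using v by simp
    also have "\<dots> = (\<Sum>i\<in>(UNIV :: 'n set). c' (index i) * (y $ j) ^ (?q * ?q ^ index i))"
      by (simp add: v_def c'_def inv_into_index matrix_vector_mult_def frob_matrix_def mult.commute)
    also have "\<dots> = (\<Sum>k<Suc (?n - 1). c' k * (y $ j) ^ (?q * ?q ^ k))" by (simp add: sum_index[of "\<lambda>k. c' k * (y $ j) ^ (?q * ?q ^ k)"])
    finally have "0 = (\<Sum>k<Suc (?n - 1). c' k * (y $ j) ^ (?q * ?q ^ k))" .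
    moreover have "index i1 = ?n - 1" using i1 by simp
    then have "c' (?n - 1) = 0" using c1 inv_into_index[of i1] by (simp add: c'_def)
    ultimately show ?thesis by (simp only: sum.lessThan_Suc mult_zero_left add_0_right)
  qed
  then have c': "c' k = 0" if "k < ?n - 1" for k using indep that by blast
  have "c $ i = 0" for i
  proof (cases "i = i1")
    case False
    then have "index i < ?n - 1"
      using index_less[of i] index_eq_iff[of i i1] i1 by linarith
    then show ?thesis using c'[of "index i"] by (simp add: c'_def inv_into_index)
  qed (simp add: c1)
  then show False using c(2) by (simp add: vec_eq_iff)
qed

lemma det_frob_matrix_power: "det (frob_matrix (CARD('a)) y) = det (frob_matrix 1 y) ^ CARD('a)"
proof -
  have "frob_matrix (CARD('a)) y = map_matrix (\<lambda>a. a ^ CARD('a)) (frob_matrix 1 y)"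
    by (simp add: vec_eq_iff frob_matrix_def mult.commute flip: power_mult)
  moreover have "(a + b) ^ CARD('a) = a ^ CARD('a) + b ^ CARD('a)" for a b :: 'l
    using power_sum[OF char_power_card, of "\<lambda>i. if i then a else b" UNIV] by (simp add: UNIV_bool add.commute)
  ultimately show ?thesis
    using det_map_matrix_hom[of "\<lambda>a :: 'l. a ^ CARD('a)"] by (simp add: power_mult_distrib)
qed

text \<open>
  With \<open>P\<close> the Moore matrix of \<open>y\<close>, the Gram matrix of the twists below \<open>N\<close> has determinant
  \<open>det A * det P ^ 2\<close>, so \<open>det P ^ 2\<close> lies in \<open>E\<close>. The shifted matrix \<open>G\<close> has determinant
  \<open>det A * det P ^ (q + 1)\<close>, and \<open>q + 1\<close> is even. Since \<open>det G\<close> is an affine function of its only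
  unknown entry, that entry lies in \<open>E\<close> when its cofactor is nonzero.
\<close>

lemma next_symmetric_form_in_subfield:
  fixes A :: "'a ^ 'n ^ 'n::finite" and y :: "'l ^ 'n"
  assumes E: "is_subfield E" "range emb \<subseteq> E" and q: "odd (CARD('a))"
    and A: "transpose A = A" "det A \<noteq> 0"
    and low: "\<And>k. k < CARD('n) \<Longrightarrow> form A y (vpow y (CARD('a) ^ k)) \<in> E"
    and minor: "det (minor_matrix emb (CARD('a)) A y) \<noteq> 0"
  shows "form A y (vpow y (CARD('a) ^ CARD('n))) \<in> E"
proof -
  let ?q = "CARD('a)" and ?n = "CARD('n)"
  let ?f = "\<lambda>i j. form A (vpow y (?q ^ i)) (vpow y (?q ^ j))"
  have shift: "?f i (i + k) = form A y (vpow y (?q ^ k)) ^ (?q ^ i)" for i k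
    by (simp add: form_power_card vpow_vpow power_add mult.commute)
  have sym: "?f i j = ?f j i" for i j
    using form_transpose[of A "vpow y (?q ^ i)" "vpow y (?q ^ j)"] A(1) by simp
  have le: "?f i j \<in> E" if "i \<le> j" "j < i + ?n" for i j
    using that shift[of i "j - i"] low[of "j - i"] subfield_power[OF E(1)] by simp
  have f: "?f i j \<in> E" if "i < j + ?n" "j < i + ?n" for i j
    using that le[of i j] le[of j i] sym[of i j] by (cases "i \<le> j") auto
  obtain i0 i1 :: 'n where i0: "index i0 = 0" and i1: "Suc (index i1) = ?n"
    by (rule index_endpoints)
  define P where "P = frob_matrix 1 y"
  define R where "R = frob_matrix ?q y"
  have G0: "(transpose P ** map_matrix emb A ** P) $ i $ j = ?f (index i) (index j)" for i j
    unfolding gram_matrix_nth P_def column_frob_matrix by simp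
  define G where "G = transpose P ** map_matrix emb A ** R"
  have G: "G $ i $ j = ?f (index i) (Suc (index j))" for i j
    unfolding G_def gram_matrix_nth P_def R_def column_frob_matrix by simp
  have detA: "emb (det A) \<in> E" using E(2) by blast
  have "det (transpose P ** map_matrix emb A ** P) \<in> E"
    by (rule det_in_subfield[OF E(1)], unfold G0, rule f) (simp_all add: index_less trans_less_add2)
  then have "det P ^ 2 * emb (det A) \<in> E"
    by (simp add: det_mul det_map_matrix_emb power2_eq_square mult_ac)
  then have "(det P ^ 2 * emb (det A)) / emb (det A) \<in> E"
    by (rule subfield_divide[OF E(1) _ detA])
  then have P2: "det P ^ 2 \<in> E" using A(2) by simp
  obtain m where m: "?q + 1 = 2 * m" using q by (metis even_plus_one_iff evenE)
  have "det P * det R = det P ^ (?q + 1)"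
    unfolding R_def P_def det_frob_matrix_power by simp
  also have "\<dots> = (det P ^ 2) ^ m" by (simp only: m power_mult)
  finally have "det P * det R \<in> E" using P2 subfield_power[OF E(1)] by simp
  then have detG: "det G \<in> E"
    using subfield_mult[OF E(1) _ detA, of "det P * det R"]
    by (simp add: G_def det_mul det_map_matrix_emb mult_ac)
  have entry: "G $ i $ j \<in> E" if "i \<noteq> i0 \<or> j \<noteq> i1" for i j
  proof -
    have "index i \<noteq> 0 \<or> Suc (index j) < ?n"
      using that index_eq_iff[of i i0] index_eq_iff[of j i1] i0 i1 index_less[of j] by linarith
    then show ?thesis unfolding G using index_less[of i] index_less[of j] by (intro f) linarith+
  qed
  have minor_eq: "minor_matrix emb ?q A y = (\<chi> i. if i = i0 then axis i1 1 else G $ i)"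
  proof -
    have "minor_matrix emb ?q A y $ i $ j = (if i = i0 then axis i1 1 else G $ i) $ j" for i j
      using index_eq_iff[of i i0] index_eq_iff[of j i1] i0 i1
      by (auto simp: minor_matrix_nth G column_frob_matrix axis_def)
    then show ?thesis by (simp add: vec_eq_iff)
  qed
  have minor_E: "det (minor_matrix emb ?q A y) \<in> E"
    unfolding minor_eq
    by (rule det_in_subfield[OF E(1)])
      (use entry subfield_0[OF E(1)] subfield_1[OF E(1)] in \<open>auto simp: axis_def\<close>)
  have rest: "det (\<chi> i. if i = i0 then G $ i0 - G $ i0 $ i1 *s axis i1 1 else G $ i) \<in> E" (is "?D \<in> E")
    by (rule det_in_subfield[OF E(1)])
      (use entry subfield_0[OF E(1)] in \<open>auto simp: axis_def\<close>)
  have "G $ i0 $ i1 * det (minor_matrix emb ?q A y) = det G - ?D"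
    unfolding minor_eq using det_replace_row[of G i0 i1] by (simp add: algebra_simps)
  then have "G $ i0 $ i1 = (det G - ?D) / det (minor_matrix emb ?q A y)"
    using minor by (simp add: nonzero_eq_divide_eq)
  also have "\<dots> \<in> E"
    by (intro subfield_divide[OF E(1)] subfield_diff[OF E(1)] detG rest minor_E)
  finally show ?thesis unfolding G i0 i1 by simp
qed

end

lemma odd_CHAR_imp_two_nonzero: "odd CHAR('a::field) \<Longrightarrow> (2 :: 'a) \<noteq> 0"
proof
  assume odd: "odd CHAR('a)" and "(2 :: 'a) = 0"
  then have "CHAR('a) dvd 2" using of_nat_eq_0_iff_char_dvd[of 2, where 'a = 'a] by simp
  then have "CHAR('a) = 1" using odd by (metis dvd_refl prime_nat_iff two_is_prime_nat)
  then show False using CHAR_not_1[where 'a = 'a] by simp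
qed

lemma anisotropic_vector_exists:
  fixes A :: "'a::field ^ 'n ^ 'n::finite"
  assumes two: "(2 :: 'a) \<noteq> 0" and sym: "transpose A = A" and nz: "A \<noteq> 0"
  obtains w where "scalar_product w (A *v w) \<noteq> 0"
proof -
  obtain i j where ij: "A $ i $ j \<noteq> 0" using nz by (auto simp: vec_eq_iff)
  have axis: "scalar_product (axis k 1) v = v $ k" for k and v :: "'a ^ 'n"
    by (simp add: scalar_product_def axis_def if_distrib[of "\<lambda>x. x * _"] cong: if_cong)
  have Aaxis: "(A *v axis k 1) $ l = A $ l $ k" for k l
    by (simp add: matrix_vector_mult_def axis_def if_distrib[of "\<lambda>x. _ * x"] cong: if_cong)
  have add: "scalar_product (u + v) w = scalar_product u w + scalar_product v w" for u v w :: "'a ^ 'n"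
    by (simp add: scalar_product_def algebra_simps sum.distrib)
  have "A $ j $ i = A $ i $ j" using sym by (metis transpose_nth)
  then have "scalar_product (axis i 1 + axis j 1) (A *v (axis i 1 + axis j 1)) =
      A $ i $ i + A $ j $ j + 2 * A $ i $ j"
    by (simp add: add axis Aaxis matrix_vector_right_distrib)
  moreover have "scalar_product (axis k 1) (A *v axis k 1) = A $ k $ k" for k
    by (simp add: axis Aaxis)
  ultimately show ?thesis
    using that two ij by (metis add_0_left mult_eq_0_iff)
qed

text \<open>
  As the cofactor is a polynomial in the coordinates, it is enough that some substitution makes it
  nonzero. The substitution projects the vector of coordinates onto the hyperplane orthogonal to an
  anisotropic vector \<open>w\<close> of the ground field.
\<close>

lemma det_minor_matrix_coord_vec_nonzero:
  fixes A :: "'a::{field,finite} ^ 'n ^ 'n::finite" and i\<^sub>1 :: 'm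
  assumes odd: "odd CHAR('a)" and A: "transpose A = A" "det A \<noteq> 0"
  shows "det (minor_matrix rconst (CARD('a)) A (coord_vec i\<^sub>1 :: ('a, 'm, 'n) ratfun ^ 'n)) \<noteq> 0"
proof
  let ?q = "CARD('a)" and ?x = "coord_vec i\<^sub>1 :: ('a, 'm, 'n) ratfun ^ 'n"
  assume zero: "det (minor_matrix rconst ?q A ?x) = 0"
  have "A \<noteq> 0" using A(2) by (metis det_0 mat_0)
  then obtain w where w: "scalar_product w (A *v w) \<noteq> 0"
    using anisotropic_vector_exists[OF odd_CHAR_imp_two_nonzero[OF odd] A(1)] by blast
  \<comment> \<open>\<open>T\<close> annihilates \<open>A w\<close>, and \<open>u\<close> can be recovered from \<open>T u\<close> and \<open>w \<bullet> u\<close>, so \<open>T\<close> has corank one.\<close>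
  define g where "g = (\<chi> i. (A *v w) $ i / scalar_product w (A *v w))"
  define T :: "'a ^ 'n ^ 'n" where "T = (\<chi> i j. (if i = j then 1 else 0) - g $ i * w $ j)"
  have Tv: "T *v u = u - scalar_product w u *s g" for u
  proof -
    have "(T *v u) $ i = (u - scalar_product w u *s g) $ i" for i
    proof -
      have "(T *v u) $ i = (\<Sum>j\<in>UNIV. (if i = j then u $ j else 0) - g $ i * (w $ j * u $ j))"
        unfolding matrix_vector_mult_def vec_lambda_beta
        by (rule sum.cong) (simp_all add: T_def algebra_simps)
      also have "\<dots> = u $ i - g $ i * scalar_product w u"
        by (simp add: sum_subtractf scalar_product_def sum_distrib_left)
      finally show ?thesis by (simp add: mult.commute)
    qed
    then show ?thesis by (simp add: vec_eq_iff)
  qed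
  have TAw: "T *v (A *v w) = 0"
    unfolding Tv using w by (simp add: vec_eq_iff g_def)
  let ?y = "?x v* map_matrix rconst T"
  let ?u = "(\<chi> j. rconst (w $ j)) :: ('a, 'm, 'n) ratfun ^ 'n"
  let ?\<iota> = "\<lambda>p :: ('a, 'm, 'n) mpol. Fraction_Field.Fract p 1"
  let ?X = "(\<chi> j. pvar (Coord i\<^sub>1 j)) :: ('a, 'm, 'n) mpol ^ 'n"
  have \<iota>: "?\<iota> 1 = 1" "?\<iota> (p + p') = ?\<iota> p + ?\<iota> p'" "?\<iota> (p * p') = ?\<iota> p * ?\<iota> p'" for p p'
    by (simp_all add: One_fract_def)
  have "?\<iota> (det (minor_matrix pconst ?q A ?X)) = det (minor_matrix (\<lambda>c. ?\<iota> (pconst c)) ?q A (\<chi> j. ?\<iota> (?X $ j)))"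
    by (rule det_minor_matrix_hom[of ?\<iota>, OF \<iota>])
  also have "\<dots> = 0"
    using zero by (simp add: rconst_def[abs_def] coord_vec_def)
  finally have 0: "det (minor_matrix pconst ?q A ?X) = 0"
    by (simp add: Zero_fract_def eq_fract)
  let ?h = "\<lambda>p :: ('a, 'm, 'n) mpol. ?\<iota> (psubst (lin_coord T) p)"
  have h: "?h 1 = 1" "?h (p + p') = ?h p + ?h p'" "?h (p * p') = ?h p * ?h p'" for p p'
    by (simp_all only: psubst_1 psubst_add psubst_mult \<iota>)
  have "?h (det (minor_matrix pconst ?q A ?X)) = det (minor_matrix (\<lambda>c. ?h (pconst c)) ?q A (\<chi> j. ?h (?X $ j)))"
    by (rule det_minor_matrix_hom[of ?h, OF h])
  moreover have "(\<lambda>c. ?h (pconst c)) = rconst" by (simp add: rconst_def fun_eq_iff)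
  moreover have "(\<chi> j. ?h (?X $ j)) = ?y"
    by (simp only: vec_eq_iff vec_lambda_beta vector_matrix_mult_def coord_vec_def rconst_def
        psubst_pvar lin_coord.simps nth_map_matrix Fract_hom simp_thms)
  ultimately have "det (minor_matrix rconst ?q A ?y) = ?\<iota> 0"
    using 0 by simp
  then have zero': "det (minor_matrix rconst ?q A ?y) = 0"
    by (simp add: Zero_fract_def)
  moreover have "det (minor_matrix rconst ?q A ?y) \<noteq> 0"
  proof (rule rconst.det_minor_matrix_nonzero[OF A(2), where u = ?u])
    have comb: "rconst.combination ?y u = rconst.combination ?x (T *v u)" for u
    proof -
      have "rconst.combination ?y u = (\<Sum>j\<in>UNIV. \<Sum>i\<in>UNIV. ?x $ i * rconst (T $ i $ j * u $ j))"
        by (simp add: rconst.combination_def vector_matrix_mult_def sum_distrib_left rconst.emb_mult mult_ac)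
      also have "\<dots> = (\<Sum>i\<in>UNIV. \<Sum>j\<in>UNIV. ?x $ i * rconst (T $ i $ j * u $ j))"
        by (rule sum.swap)
      finally show ?thesis
        by (simp add: rconst.combination_def matrix_vector_mult_def rconst.emb_sum sum_distrib_left mult.commute)
    qed
    have "range (rconst.combination ?y) = rconst.combination ?x ` range ((*v) T)"
      by (auto simp: comb image_image)
    then have card1: "card (range (rconst.combination ?y)) = card (range ((*v) T))"
      using card_image[OF inj_on_subset[OF inj_combination_coord_vec[of i\<^sub>1] subset_UNIV]] by metis
    have "inj (\<lambda>u. (T *v u, scalar_product w u))"
    proof (rule injI)
      fix u u' assume "(T *v u, scalar_product w u) = (T *v u', scalar_product w u')"
      then have "T *v u = T *v u'" "scalar_product w u = scalar_product w u'" by simp_all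
      then show "u = u'" unfolding Tv by (simp only: diff_conv_add_uminus add_right_cancel)
    qed
    then have "CARD('a ^ 'n) = card (range (\<lambda>u. (T *v u, scalar_product w u)))"
      by (rule card_image[symmetric])
    also have "\<dots> \<le> card (range ((*v) T) \<times> (UNIV :: 'a set))"
      by (rule card_mono) auto
    finally have "?q ^ CARD('n) \<le> card (range ((*v) T)) * ?q"
      by (simp add: card_cartesian_product)
    moreover have "?q ^ CARD('n) = ?q ^ (CARD('n) - 1) * ?q"
      using power_Suc2[of ?q "CARD('n) - 1"] by simp
    ultimately have "?q ^ (CARD('n) - 1) \<le> card (range ((*v) T))"
      by simp
    then show "?q ^ (CARD('n) - 1) \<le> card (range (rconst.combination ?y))"
      using card1 by simp
    show "vpow ?u ?q = ?u"
      by (simp add: vec_eq_iff rconst.emb_power[symmetric] power_card_finite_field)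
    have A_u: "map_matrix rconst B *v ?u = (\<chi> j. rconst ((B *v w) $ j))" for B
      by (simp add: vec_eq_iff matrix_vector_mult_def rconst.emb_sum rconst.emb_mult)
    have "rconst.form A ?u ?y = rconst.form (T ** A) ?x ?u"
      using rconst.form_transpose[of A ?u ?y] by (simp add: A(1) rconst.form_left_mult)
    also have "\<dots> = 0"
      unfolding rconst.form_eq_row A_u using TAw by (simp add: matrix_vector_mul_assoc[symmetric])
    finally show "rconst.form A ?u ?y = 0" .
    have "rconst.form A ?u ?u = rconst (scalar_product w (A *v w))"
      unfolding rconst.form_eq_row A_u by (simp add: scalar_product_def rconst.emb_sum rconst.emb_mult)
    then show "rconst.form A ?u ?u \<noteq> 0" using w by simp
  qed
  ultimately show False by blast
qed

section \<open>The symplectic, unitary and orthogonal groups\<close>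

text \<open>
  The vanishing diagonal is what makes this true in characteristic two.
\<close>

lemma sum_antisymmetric_eq_0:
  fixes g :: "'i \<Rightarrow> 'i \<Rightarrow> 'r::comm_ring_1"
  assumes "finite I" and g: "\<And>i j. g i j = - g j i" "\<And>i. g i i = 0"
  shows "(\<Sum>i\<in>I. \<Sum>j\<in>I. g i j) = 0"
  using assms(1)
proof (induction I rule: finite_induct)
  case (insert x I)
  have "(\<Sum>i\<in>I. g i x) = - (\<Sum>j\<in>I. g x j)"
    unfolding sum_negf[symmetric] by (rule sum.cong[OF refl], rule g(1))
  then show ?case
    using insert by (simp add: g(2) sum.distrib)
qed simp

context finite_field_embedding
begin

lemma form_frobenius_shift:
  "form M (vpow y (CARD('a) ^ i)) (vpow y (r * CARD('a) ^ (i + k))) =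
    form M y (vpow y (r * CARD('a) ^ k)) ^ (CARD('a) ^ i)"
  by (simp add: form_power_card vpow_vpow power_add mult_ac)

lemma form_alternate:
  assumes "alternate_matrix K"
  shows "form K u u = 0" and "form K u v = - form K v u"
proof -
  have K: "K $ i $ j = - K $ j $ i" "K $ i $ i = 0" for i j
    using assms unfolding alternate_matrix_def by (metis neg_0_equal_iff_equal, blast)
  show "form K u u = 0"
    unfolding form_sum
  proof (rule sum_antisymmetric_eq_0)
    show "u $ i * emb (K $ i $ j) * u $ j = - (u $ j * emb (K $ j $ i) * u $ i)" for i j
      using K(1)[of i j] by (simp add: emb_uminus mult_ac)
  qed (simp_all add: K(2))
  have "transpose K = - K"
    by (simp add: vec_eq_iff transpose_def) (use K(1) in blast)
  then show "form K u v = - form K v u"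
    using form_transpose[of K v u] by (simp add: form_uminus)
qed

end

text \<open>
  The pairing of \<open>y ^ (q ^ i)\<close> with \<open>y ^ (q ^ j)\<close> is a power of a generator for \<open>i < j\<close>, zero for
  \<open>i = j\<close>, and determined by antisymmetry for \<open>i > j\<close>.
\<close>

lemma fixed_field_symplectic_group:
  fixes K :: "'a::{field,finite} ^ 'n ^ 'n::finite" and i\<^sub>1 :: 'm
  assumes K: "alternate_matrix K" "invertible K"
  shows "(fixed_field (symplectic_group K) :: ('a, 'm, 'n) ratfun set) =
    adjoin {frob_form K i i\<^sub>1 (CARD('a) ^ k) | i k. 1 \<le> k \<and> k \<le> CARD('n)}"
    (is "_ = adjoin ?S")
proof -
  let ?y = "coord_vec i\<^sub>1 :: ('a, 'm, 'n) ratfun ^ 'n"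
  note E = is_subfield_adjoin[of ?S]
  have "symplectic_group K = {T. invertible T \<and> T ** K ** transpose (conj_matrix 1 T) = K}"
    by (simp add: symplectic_group_def conj_matrix_def map_matrix_def)
  also have "fixed_field \<dots> = adjoin ?S"
  proof (rule fixed_field_isometry_group[OF rconst.char_power_1])
    show "det K \<noteq> 0" using K(2) by (simp add: invertible_det_nz)
    show "?S = {frob_form K i i\<^sub>1 (1 * CARD('a) ^ (1 + k)) | i k. k < CARD('n)}"
    proof (intro Collect_cong iffI)
      show "\<exists>i k. f = frob_form K i i\<^sub>1 (1 * CARD('a) ^ (1 + k)) \<and> k < CARD('n)"
        if f: "\<exists>i k. f = frob_form K i i\<^sub>1 (CARD('a) ^ k) \<and> 1 \<le> k \<and> k \<le> CARD('n)" for f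
      proof -
        from f obtain i k where "f = frob_form K i i\<^sub>1 (CARD('a) ^ k)" "1 \<le> k" "k \<le> CARD('n)" by blast
        then have "f = frob_form K i i\<^sub>1 (1 * CARD('a) ^ (1 + (k - 1)))" "k - 1 < CARD('n)" by auto
        then show ?thesis by blast
      qed
      show "\<exists>i k. f = frob_form K i i\<^sub>1 (CARD('a) ^ k) \<and> 1 \<le> k \<and> k \<le> CARD('n)"
        if f: "\<exists>i k. f = frob_form K i i\<^sub>1 (1 * CARD('a) ^ (1 + k)) \<and> k < CARD('n)" for f
      proof -
        from f obtain i k where "f = frob_form K i i\<^sub>1 (1 * CARD('a) ^ (1 + k))" "k < CARD('n)" by blast
        then have "f = frob_form K i i\<^sub>1 (CARD('a) ^ (1 + k))" "1 \<le> 1 + k" "1 + k \<le> CARD('n)" by auto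
        then show ?thesis by blast
      qed
    qed
    have low: "rconst.form K ?y (vpow ?y (CARD('a) ^ k)) \<in> adjoin ?S" if "1 \<le> k" "k \<le> CARD('n)" for k
      using that subset_adjoin(2)[of ?S] by (auto simp: frob_form_eq_form)
    have lt: "rconst.form K (vpow ?y (CARD('a) ^ i)) (vpow ?y (CARD('a) ^ j)) \<in> adjoin ?S"
      if "i < j" "j \<le> CARD('n)" for i j
      using that subfield_power[OF E low[of "j - i"]] rconst.form_frobenius_shift[of K ?y i 1 "j - i"]
      by simp
    show "rconst.form K (vpow ?y (CARD('a) ^ i)) (vpow ?y (1 * CARD('a) ^ j)) \<in> adjoin ?S"
      if "i \<le> CARD('n)" "j < CARD('n)" for i j
    proof (cases i j rule: linorder_cases)
      case less
      then show ?thesis using that lt[of i j] by simp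
    next
      case equal
      then show ?thesis using rconst.form_alternate(1)[OF K(1), of "vpow ?y (CARD('a) ^ j)"] subfield_0[OF E] by simp
    next
      case greater
      then show ?thesis
        using that lt[of j i] subfield_uminus[OF E]
          rconst.form_alternate(2)[OF K(1), of "vpow ?y (CARD('a) ^ i)" "vpow ?y (CARD('a) ^ j)"]
        by simp
    qed
  qed
  finally show ?thesis .
qed

text \<open>
  Here \<open>r = q\<close> and the ground field has order \<open>q\<^sup>2\<close>. For \<open>i \<le> j\<close> the pairing of \<open>y ^ (q ^ (2 * i))\<close> with
  \<open>y ^ (q ^ (2 * j + 1))\<close> is a power of a generator. For \<open>i > j\<close> the Hermitian symmetry turns it into
  the \<open>q\<close>-th power of the pairing of \<open>y ^ (q ^ (2 * j))\<close> with \<open>y ^ (q ^ (2 * i - 1))\<close>.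
\<close>

lemma fixed_field_unitary_group:
  fixes H :: "'b::{field,finite} ^ 'n ^ 'n::finite" and i\<^sub>1 :: 'm
  assumes q: "CARD('b) = q\<^sup>2" and H: "hermitian_matrix q H" "invertible H"
  shows "(fixed_field (unitary_group q H) :: ('b, 'm, 'n) ratfun set) =
    adjoin {frob_form H i i\<^sub>1 (q ^ (2 * k + 1)) | i k. k < CARD('n)}"
    (is "_ = adjoin ?S")
proof -
  let ?y = "coord_vec i\<^sub>1 :: ('b, 'm, 'n) ratfun ^ 'n"
  note E = is_subfield_adjoin[of ?S]
  have exp: "q ^ (2 * k + 1) = q * CARD('b) ^ k" for k
    by (simp add: q power_mult)
  obtain e where "CARD('b) = CHAR('b) ^ e"
    using card_finite_field_eq_CHAR_power by blast
  then have "q dvd CHAR('b) ^ e"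
    using q by (metis dvd_triv_left power2_eq_square)
  then have char: "rconst.char_power TYPE('b) q"
    unfolding rconst.char_power_def divides_primepow_nat[OF rconst.prime_CHAR] by blast
  show ?thesis
    unfolding unitary_group_def
  proof (rule fixed_field_isometry_group[OF char, where s = 0])
    show "det H \<noteq> 0" using H(2) by (simp add: invertible_det_nz)
    show "?S = {frob_form H i i\<^sub>1 (q * CARD('b) ^ (0 + k)) | i k. k < CARD('n)}"
      by (simp only: exp add_0_left)
    have low: "rconst.form H ?y (vpow ?y (q * CARD('b) ^ k)) \<in> adjoin ?S" if "k < CARD('n)" for k
      using that subset_adjoin(2)[of ?S] unfolding exp by (auto simp: frob_form_eq_form)
    have le: "rconst.form H (vpow ?y (CARD('b) ^ i)) (vpow ?y (q * CARD('b) ^ (i + k))) \<in> adjoin ?S"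
      if "k < CARD('n)" for i k
      unfolding rconst.form_frobenius_shift by (intro subfield_power[OF E] low that)
    show "rconst.form H (vpow ?y (CARD('b) ^ i)) (vpow ?y (q * CARD('b) ^ j)) \<in> adjoin ?S"
      if ij: "i \<le> CARD('n)" "j < CARD('n)" for i j
    proof (cases "i \<le> j")
      case True
      then show ?thesis using le[of "j - i" i] ij by simp
    next
      case False
      then obtain k where k: "i = j + k + 1"
        by (metis add.commute add.assoc less_imp_Suc_add not_le Suc_eq_plus1)
      have H': "transpose H = map_matrix (\<lambda>a. a ^ q) H"
        using H(1) transpose_transpose unfolding hermitian_matrix_def conj_matrix_def by metis
      have "CARD('b) ^ i = (q * CARD('b) ^ (j + k)) * q"
        unfolding k by (simp add: q power2_eq_square mult_ac)
      then have "rconst.form H (vpow ?y (CARD('b) ^ i)) (vpow ?y (q * CARD('b) ^ j)) =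
          rconst.form H (vpow ?y (CARD('b) ^ j)) (vpow ?y (q * CARD('b) ^ (j + k))) ^ q"
        unfolding rconst.form_power[OF char] H'[symmetric] rconst.form_transpose
        by (simp add: vpow_vpow mult.commute)
      then show ?thesis using le[of k j] ij k subfield_power[OF E] by simp
    qed
  qed
qed

text \<open>
  By symmetry and Frobenius a pairing of twists depends only on the difference of their exponents, up
  to a power. It is at most \<open>N\<close>, and the difference \<open>N\<close> is covered by \<open>next_symmetric_form_in_subfield\<close>.
\<close>

lemma fixed_field_orthogonal_group:
  fixes A :: "'a::{field,finite} ^ 'n ^ 'n::finite" and i\<^sub>1 :: 'm
  assumes odd: "odd CHAR('a)" and A: "symmetric_matrix A" "invertible A"
  shows "(fixed_field (orthogonal_group A) :: ('a, 'm, 'n) ratfun set) =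
    adjoin {frob_form A i i\<^sub>1 (CARD('a) ^ k) | i k. k < CARD('n)}"
    (is "_ = adjoin ?S")
proof -
  let ?y = "coord_vec i\<^sub>1 :: ('a, 'm, 'n) ratfun ^ 'n"
  note E = is_subfield_adjoin[of ?S]
  have sym: "transpose A = A" using A(1) by (simp add: symmetric_matrix_def)
  have det: "det A \<noteq> 0" using A(2) by (simp add: invertible_det_nz)
  have "odd (CARD('a))"
    using card_finite_field_eq_CHAR_power[where 'a = 'a] odd by (metis even_power)
  have low: "rconst.form A ?y (vpow ?y (CARD('a) ^ k)) \<in> adjoin ?S" if "k < CARD('n)" for k
    using that subset_adjoin(2)[of ?S] by (auto simp: frob_form_eq_form)
  have "rconst.form A ?y (vpow ?y (CARD('a) ^ CARD('n))) \<in> adjoin ?S"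
    by (rule rconst.next_symmetric_form_in_subfield[OF E subset_adjoin(1) \<open>odd (CARD('a))\<close> sym det low
        det_minor_matrix_coord_vec_nonzero[OF odd sym det]])
  with low have low': "rconst.form A ?y (vpow ?y (CARD('a) ^ k)) \<in> adjoin ?S" if "k \<le> CARD('n)" for k
    using that by (cases "k = CARD('n)") auto
  have le: "rconst.form A (vpow ?y (CARD('a) ^ i)) (vpow ?y (CARD('a) ^ j)) \<in> adjoin ?S"
    if "i \<le> j" "j \<le> CARD('n)" for i j
    using that subfield_power[OF E low'[of "j - i"]] rconst.form_frobenius_shift[of A ?y i 1 "j - i"]
    by simp
  have "orthogonal_group A = {T. invertible T \<and> T ** A ** transpose (conj_matrix 1 T) = A}"
    by (simp add: orthogonal_group_def conj_matrix_def map_matrix_def)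
  also have "fixed_field \<dots> = adjoin ?S"
  proof (rule fixed_field_isometry_group[OF rconst.char_power_1 det, where s = 0])
    show "?S = {frob_form A i i\<^sub>1 (1 * CARD('a) ^ (0 + k)) | i k. k < CARD('n)}" by simp
    show "rconst.form A (vpow ?y (CARD('a) ^ i)) (vpow ?y (1 * CARD('a) ^ j)) \<in> adjoin ?S"
      if "i \<le> CARD('n)" "j < CARD('n)" for i j
      using that le[of i j] le[of j i]
        rconst.form_transpose[of A "vpow ?y (CARD('a) ^ i)" "vpow ?y (CARD('a) ^ j)"]
      by (cases "i \<le> j") (simp_all add: sym)
  qed
  finally show ?thesis .
qed

theorem theorem4p1:
  fixes K A :: "'a::{field,finite} ^ 'n ^ 'n::finite"
    and H :: "'b::{field,finite} ^ 'n ^ 'n"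
    and i\<^sub>1 :: "'m::finite"
    and n :: nat
  shows
    "(CARD('n) = 2 * n \<and> alternate_matrix K \<and> invertible K \<longrightarrow>
        (fixed_field (symplectic_group K) :: ('a, 'm, 'n) ratfun set) =
          adjoin {frob_form K i i\<^sub>1 (CARD('a) ^ k) | i k. 1 \<le> k \<and> k \<le> 2 * n}) \<and>
     (odd CHAR('a) \<and> CARD('b) = CARD('a)\<^sup>2 \<and> CARD('n) = n \<and>
        hermitian_matrix CARD('a) H \<and> invertible H \<longrightarrow>
        (fixed_field (unitary_group CARD('a) H) :: ('b, 'm, 'n) ratfun set) =
          adjoin {frob_form H i i\<^sub>1 (CARD('a) ^ (2 * k + 1)) | i k. k \<le> n - 1}) \<and>
     (odd CHAR('a) \<and> CARD('n) = n \<and> symmetric_matrix A \<and> invertible A \<longrightarrow>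
        (fixed_field (orthogonal_group A) :: ('a, 'm, 'n) ratfun set) =
          adjoin {frob_form A i i\<^sub>1 (CARD('a) ^ k) | i k. k \<le> n - 1})"
proof -
  have less: "k \<le> CARD('n) - 1 \<longleftrightarrow> k < CARD('n)" for k
    using zero_less_card_finite[where 'a = 'n] by linarith
  show ?thesis
  proof (intro conjI impI; elim conjE)
    assume "CARD('n) = 2 * n" "alternate_matrix K" "invertible K"
    then show "(fixed_field (symplectic_group K) :: ('a, 'm, 'n) ratfun set) =
        adjoin {frob_form K i i\<^sub>1 (CARD('a) ^ k) | i k. 1 \<le> k \<and> k \<le> 2 * n}"
      using fixed_field_symplectic_group[of K i\<^sub>1] by simp
  next
    assume *: "CARD('b) = CARD('a)\<^sup>2" "hermitian_matrix CARD('a) H" "invertible H"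
      and n: "CARD('n) = n"
    show "(fixed_field (unitary_group CARD('a) H) :: ('b, 'm, 'n) ratfun set) =
        adjoin {frob_form H i i\<^sub>1 (CARD('a) ^ (2 * k + 1)) | i k. k \<le> n - 1}"
      unfolding n[symmetric] less by (rule fixed_field_unitary_group[OF *])
  next
    assume *: "odd CHAR('a)" "symmetric_matrix A" "invertible A" and n: "CARD('n) = n"
    show "(fixed_field (orthogonal_group A) :: ('a, 'm, 'n) ratfun set) =
        adjoin {frob_form A i i\<^sub>1 (CARD('a) ^ k) | i k. k \<le> n - 1}"
      unfolding n[symmetric] less by (rule fixed_field_orthogonal_group[OF *])
  qed
qed

end
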